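(* There is a universal constant $C>0$ such that the following holds. Assume conditions (1)–(5) of the context on $f_1,\dots,f_M$ and the stochastic gradients, with constants $L_1, L_3,\zeta,\beta,\sigma_2,\sigma_4\ge 0$ and $L_2>0$. Assume moreover that: (QL1) for all $c\in[M]$ and $\theta\in\mathbb{R}^d$, $\mu_c(\theta)>0$, where $\mu_c(\theta)=\sup\{x\ge 0:\ \|\nabla f_c(\theta)\|^2\ge 2x\,(f_c^\star-f_c(\theta))^2\}$; (QL2) there is $\underline{\mu}>0$ such that for every $\theta\in\mathbb{R}^d$, $\min_{c\in[M]}\mu_c(\mathcal{T}(\theta))\ge\underline{\mu}$ and $F(\mathcal{T}(\theta))\ge F(\theta)$. Then for any step size $\eta>0$ such that $\eta H L_2\le 1/6$ and $32\,\eta^2H^2L_3^2L_1^2\le L_2^2$, the iterates of proj-FedAVG with $H$ local steps and $R$ communication rounds satisfy $$\mathbb{E}[F^\star-F(\theta^R)]\le C\left(\frac{F^\star-F(\theta^0)}{1+R\,(F^\star-F(\theta^0))\,\eta H\underline{\mu}}+\frac{\zeta+\beta}{\sqrt{\underline{\mu}}}+\frac{\zeta^2+\beta^2}{L_2}+\sqrt{\frac{\eta L_2\sigma_2^2}{M\underline{\mu}}}+\frac{\eta\sigma_2^2}{M}+\frac{\eta^2L_3H\sigma_4^2}{\sqrt{\underline{\mu}}}+\frac{\eta^4L_3^2H^2\sigma_4^4}{L_2}\right).$$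
   Context: Setting. $M,H,R,d\ge1$ are integers, $[M]=\{1,\dots,M\}$, $\|\cdot\|$ is the Euclidean norm. For each agent $c\in[M]$, $f_c:\mathbb{R}^d\to\mathbb{R}$ is three times differentiable, and $F=\frac1M\sum_{c=1}^Mf_c$ is to be maximized. For each $c$ and $\theta$, $\xi_c(\theta)$ is a probability distribution on a measurable space $\mathsf{Z}$, and $(z,\theta)\mapsto g_c^z(\theta)\in\mathbb{R}^d$ is a measurable (possibly biased) stochastic gradient of $f_c$ with mean $g_c(\theta)=\mathbb{E}_{Z\sim\xi_c(\theta)}[g_c^Z(\theta)]$. Put $f_c^\star=\sup_\theta f_c(\theta)<\infty$ and $F^\star=\frac1M\sum_{c=1}^Mf_c^\star$. Conditions, for all $c\in[M]$ and $\theta,\theta',u\in\mathbb{R}^d$: (1) $\|\nabla f_c(\theta)\|\le L_1$; (2) $\|\nabla^2f_c(\theta)u\|\le L_2\|u\|$ and $\|g_c(\theta)-g_c(\theta')\|\le L_2\|\theta-\theta'\|$; (3) $\|\nabla^3f_c(\theta)u^{\otimes2}\|\le L_3\|u\|^2$, where $\nabla^3 f_c(\theta)u^{\otimes 2}$ is the vector obtained by contracting the third-derivative tensor twice with $u$; (4) $\|\nabla F(\theta)-\nabla f_c(\theta)\|\le\zeta$; (5) $\|\nabla f_c(\theta)-g_c(\theta)\|\le\beta$ and $\mathbb{E}_{Z\sim\xi_c(\theta)}[\|g_c^Z(\theta)-g_c(\theta)\|^p]\le\sigma_p^p$ for $p\in\{2,4\}$. Algorithm proj-FedAVG (step size $\eta$,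 operator $\mathcal{T}:\mathbb{R}^d\to\mathbb{R}^d$, deterministic initial point $\theta^0$). For $r=0,\dots,R-1$: each agent sets $\theta_c^{r,0}=\theta^r$ and, for $h=0,\dots,H-1$, draws $Z_c^{r,h+1}$ which conditionally on the past has law $\xi_c(\theta_c^{r,h})$ and sets $\theta_c^{r,h+1}=\theta_c^{r,h}+\eta\,g_c^{Z_c^{r,h+1}}(\theta_c^{r,h})$; the agents' draws within a round are independent across agents conditionally on the previous rounds. Then $\bar\theta^{r+1}=\frac1M\sum_{c=1}^M\theta_c^{r,H}$ and $\theta^{r+1}=\mathcal{T}(\bar\theta^{r+1})$. *)

theory Defs
  imports "HOL-Probability.Probability"
begin

(* Derivatives of a real-valued function on R^d.  The Hessian and the third derivative are the
   bounded linear maps representing the Frechet derivatives of the gradient and of the Hessian.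
   The three definitions below are meaningful under three_times_differentiable. *)

definition grad :: "('a::euclidean_space \<Rightarrow> real) \<Rightarrow> 'a \<Rightarrow> 'a" where
  "grad f x = (THE v. GDERIV f x :> v)"

definition hess :: "('a::euclidean_space \<Rightarrow> real) \<Rightarrow> 'a \<Rightarrow> 'a \<Rightarrow>\<^sub>L 'a" where
  "hess f x = Blinfun (frechet_derivative (grad f) (at x))"

definition third_deriv :: "('a::euclidean_space \<Rightarrow> real) \<Rightarrow> 'a \<Rightarrow> 'a \<Rightarrow>\<^sub>L 'a \<Rightarrow>\<^sub>L 'a" where
  "third_deriv f x = Blinfun (frechet_derivative (hess f) (at x))"

definition three_times_differentiable :: "('a::euclidean_space \<Rightarrow> real) \<Rightarrow> bool" where
  "three_times_differentiable f \<longleftrightarrow>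
     (\<forall>x. f differentiable at x \<and> grad f differentiable at x \<and> hess f differentiable at x)"

definition fstar :: "('a \<Rightarrow> real) \<Rightarrow> real" where
  "fstar f = (SUP x. f x)"

definition avg :: "nat \<Rightarrow> (nat \<Rightarrow> 'a::real_vector) \<Rightarrow> 'a" where
  "avg M v = (1 / real M) *\<^sub>R (\<Sum>c\<in>{1..M}. v c)"

(* The supremum is taken in the extended reals: it is infinite at a maximiser of f. *)

definition QL_mu :: "('a::euclidean_space \<Rightarrow> real) \<Rightarrow> 'a \<Rightarrow> ereal" where
  "QL_mu f \<theta> = Sup (ereal ` {x. 0 \<le> x \<and> (norm (grad f \<theta>))\<^sup>2 \<ge> 2 * x * (fstar f - f \<theta>)\<^sup>2})"

definition mean_grad ::
    "('a::euclidean_space \<Rightarrow> 'z measure) \<Rightarrow> ('z \<Rightarrow> 'a \<Rightarrow> 'a) \<Rightarrow> 'a \<Rightarrow> 'a" where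
  "mean_grad \<xi> g \<theta> = (\<integral>z. g z \<theta> \<partial>\<xi> \<theta>)"

(* The algorithm is a program in the Giry monad, read as sampling.  local_run is the law of
   the local parameter of one agent after h local steps started at a given point; fed_round is
   the law of the next global parameter, the product measure expressing that, given the
   current global parameter, the agents sample independently; proj_fedavg is the law of the
   global parameter after r rounds. *)

primrec local_run ::
    "('a::euclidean_space \<Rightarrow> 'z measure) \<Rightarrow> ('z \<Rightarrow> 'a \<Rightarrow> 'a) \<Rightarrow> real \<Rightarrow> nat \<Rightarrow> 'a \<Rightarrow> 'a measure" where
  "local_run \<xi> g \<eta> 0 \<theta> = return borel \<theta>"
| "local_run \<xi> g \<eta> (Suc h) \<theta> =
     do { \<theta>' \<leftarrow> local_run \<xi> g \<eta> h \<theta>; z \<leftarrow> \<xi> \<theta>'; return borel (\<theta>' + \<eta> *\<^sub>R g z \<theta>') }"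

definition fed_round ::
    "nat \<Rightarrow> nat \<Rightarrow> (nat \<Rightarrow> 'a::euclidean_space \<Rightarrow> 'z measure) \<Rightarrow> (nat \<Rightarrow> 'z \<Rightarrow> 'a \<Rightarrow> 'a) \<Rightarrow>
     real \<Rightarrow> ('a \<Rightarrow> 'a) \<Rightarrow> 'a \<Rightarrow> 'a measure" where
  "fed_round M H \<xi> g \<eta> T \<theta> =
     do { x \<leftarrow> (\<Pi>\<^sub>M c\<in>{1..M}. local_run (\<xi> c) (g c) \<eta> H \<theta>); return borel (T (avg M x)) }"

primrec proj_fedavg ::
    "nat \<Rightarrow> nat \<Rightarrow> (nat \<Rightarrow> 'a::euclidean_space \<Rightarrow> 'z measure) \<Rightarrow> (nat \<Rightarrow> 'z \<Rightarrow> 'a \<Rightarrow> 'a) \<Rightarrow>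
     real \<Rightarrow> ('a \<Rightarrow> 'a) \<Rightarrow> 'a \<Rightarrow> nat \<Rightarrow> 'a measure" where
  "proj_fedavg M H \<xi> g \<eta> T \<theta>0 0 = return borel \<theta>0"
| "proj_fedavg M H \<xi> g \<eta> T \<theta>0 (Suc r) =
     do { \<theta> \<leftarrow> proj_fedavg M H \<xi> g \<eta> T \<theta>0 r; fed_round M H \<xi> g \<eta> T \<theta> }"

(* A universal constant must not depend on the dimension or on the sample space.  These are
   types, over which no quantifier inside a formula ranges, so a bare existential would let
   the constant vary with them.  Requiring it to be at most this fixed number makes it uniform
   over all types; the value itself has no significance. *)

definition universal_cap :: real where
  "universal_cap = 10 ^ 6"

end

(* Write eta H = s.  With noise of variance at most v, the variance of the h-th local iterate is at
   most 2 h eta^2 v, because x + eta g_c(x) is nearly nonexpansive over H steps.  The expectations m_h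
   of the local iterates follow gradient ascent on f_c up to an error b = beta + O(L3 H eta^2 v): the
   first-order effect of the noise averages out and Taylor's formula leaves L3 times the variance.
   Here Jensen gives v <= sigma4^2.  Hence E[bar theta] - theta = s (grad F(theta) + e) with
   |e| <= |grad F(theta)|/5 + O(b + zeta), while independence divides the variance of bar theta by M,
   and smoothness yields
     E[gap(theta')] <= gap(theta) - (s/2) |grad F(theta)|^2 + s N,
   with N = O(b^2 + zeta^2 + L2 eta sigma2^2 / M).
   On the range of T, (QL) gives mu gap^2 <= |grad F|^2 + zeta^2 and, with smoothness, gap <= L2/mu.
   From the second round on, the expected gap y therefore satisfies y' <= y - (s mu/2)(y^2 - q^2)
   with q^2 = O((N + zeta^2)/mu), whence y <= q + O(1/(R s mu)).  The first round may start where mu_c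
   is arbitrarily small, but one application of T brings the gap below L2/mu. *)

theory Submission
  imports Defs
begin

subsection \<open>Gradients and Taylor bounds\<close>

text \<open>Every law is summarised by \<open>mean_var\<close>: its exact mean and an upper bound
  for its variance. This pair suffices because the smoothness inequality is quadratic: its linear
  term sees only the mean, its quadratic term the mean and the variance. Bias and noise are thus
  carried separately. Integrability is the analytic obstacle. \<open>F\<close> is bounded above but
  no lower bound is given; \<open>F_lipschitz\<close> makes it integrable against any law of finite
  variance, and after a round the gap is bounded almost surely. The numerical constants grow out of
  \<open>\<eta> * H * L2 \<le> 1 / 6\<close>. Over a round the gradient along the means drifts by at
  most 6/5 * 1/6 = 1/5 of its initial norm plus error. With a = s mu / 2 and B = L2 / mu one has 2 a
  B = s L2 \<le> 1, so t - a t^2 is increasing up to B and comparison arguments apply. The recursion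
  can start only after the first round, with rate a, whereas the claimed rate counts all R rounds
  with rate 2 a; \<open>recursion_rate\<close> settles both at the cost of one factor 2.\<close>

lemma GDERIV_unique:
  fixes f :: "'a::euclidean_space \<Rightarrow> real"
  assumes "GDERIV f x :> u" "GDERIV f x :> v"
  shows "u = v"
proof -
  have "(\<lambda>h. inner h u) = (\<lambda>h. inner h v)"
    using assms unfolding gderiv_def by (rule has_derivative_unique)
  then have "inner (u - v) u = inner (u - v) v" by (rule fun_cong)
  then show ?thesis by (metis inner_diff_right inner_eq_zero_iff right_minus_eq)
qed

lemma grad_eqI:
  fixes f :: "'a::euclidean_space \<Rightarrow> real"
  shows "GDERIV f x :> v \<Longrightarrow> grad f x = v"
  unfolding grad_def using GDERIV_unique by blast

text \<open>Riesz representation in an orthonormal basis. It makes the definite description in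
  \<open>grad\<close> meaningful at every point of differentiability.\<close>

lemma GDERIV_grad:
  fixes f :: "'a::euclidean_space \<Rightarrow> real"
  assumes "f differentiable at x"
  shows "GDERIV f x :> grad f x"
proof -
  from assms obtain D where D: "(f has_derivative D) (at x)"
    by (auto simp: differentiable_def)
  interpret bounded_linear D using D by (rule has_derivative_bounded_linear)
  have "D h = inner h (\<Sum>b\<in>Basis. D b *\<^sub>R b)" for h
  proof -
    have "D h = D (\<Sum>b\<in>Basis. inner h b *\<^sub>R b)" by (simp add: euclidean_representation)
    also have "\<dots> = inner h (\<Sum>b\<in>Basis. D b *\<^sub>R b)"
      by (simp add: sum scaleR inner_sum_right mult.commute)
    finally show ?thesis .
  qed
  then have "GDERIV f x :> (\<Sum>b\<in>Basis. D b *\<^sub>R b)"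
    unfolding gderiv_def using D by (metis (no_types, lifting) ext)
  then show ?thesis using grad_eqI by metis
qed

lemma has_derivative_Blinfun_frechet:
  assumes "f differentiable at x"
  shows "(f has_derivative blinfun_apply (Blinfun (frechet_derivative f (at x)))) (at x)"
  using assms frechet_derivative_works has_derivative_bounded_linear bounded_linear_Blinfun_apply
  by metis

lemma GDERIV_avg:
  assumes "\<And>c. c \<in> {1..M} \<Longrightarrow> GDERIV (f c) x :> G c"
  shows "GDERIV (\<lambda>x. avg M (\<lambda>c. f c x)) x :> avg M G"
proof -
  have "((\<lambda>x. (1 / real M) *\<^sub>R (\<Sum>c\<in>{1..M}. f c x)) has_derivative
      (\<lambda>h. (1 / real M) *\<^sub>R (\<Sum>c\<in>{1..M}. inner h (G c)))) (at x)"
    using assms unfolding gderiv_def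
    by (intro has_derivative_scaleR_right has_derivative_sum) auto
  then show ?thesis
    unfolding gderiv_def avg_def by (simp add: inner_sum_right)
qed

text \<open>Along the segment, \<open>f\<close> minus its quadratic minorant is the function
  \<open>\<phi>\<close> up to a constant; its derivative is nonnegative by the Lipschitz bound, so
  no integral of the gradient is taken.\<close>

lemma descent_lower_bound:
  fixes f :: "'a::euclidean_space \<Rightarrow> real"
  assumes G: "\<And>x. GDERIV f x :> G x"
    and L: "\<And>x y. norm (G x - G y) \<le> L * norm (x - y)"
  shows "f x + inner (G x) (y - x) - L / 2 * (norm (y - x))\<^sup>2 \<le> f y"
proof -
  define u where "u = y - x"
  define \<phi> where "\<phi> t = f (x + t *\<^sub>R u) - t * inner (G x) u + L / 2 * (norm u)\<^sup>2 * t\<^sup>2" for t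
  define \<phi>' where "\<phi>' t = inner (G (x + t *\<^sub>R u)) u - inner (G x) u + L * (norm u)\<^sup>2 * t" for t
  have d: "(\<phi> has_real_derivative \<phi>' t) (at t)" for t
  proof -
    have "((\<lambda>t. f (x + t *\<^sub>R u)) has_derivative (\<lambda>h. inner (h *\<^sub>R u) (G (x + t *\<^sub>R u)))) (at t)"
      by (rule has_derivative_compose[where g = f and f = "\<lambda>t. x + t *\<^sub>R u"])
        (auto intro!: derivative_eq_intros G[unfolded gderiv_def])
    then have "((\<lambda>t. f (x + t *\<^sub>R u)) has_real_derivative inner (G (x + t *\<^sub>R u)) u) (at t)"
      unfolding has_field_derivative_def by (simp add: inner_commute mult.commute[of _ "inner _ _"])
    then show ?thesis
      unfolding \<phi>_def[abs_def] \<phi>'_def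
      by (auto intro!: derivative_eq_intros)
  qed
  have "0 \<le> \<phi>' t" if "0 \<le> t" for t
  proof -
    have "\<bar>inner (G (x + t *\<^sub>R u) - G x) u\<bar> \<le> norm (G (x + t *\<^sub>R u) - G x) * norm u"
      by (rule Cauchy_Schwarz_ineq2)
    also have "\<dots> \<le> (L * norm (t *\<^sub>R u)) * norm u"
      using L[of "x + t *\<^sub>R u" x] by (intro mult_right_mono) auto
    finally show ?thesis
      using that by (simp add: \<phi>'_def inner_diff_left power2_eq_square algebra_simps)
  qed
  then have "\<phi> 0 \<le> \<phi> 1"
    using d by (intro DERIV_nonneg_imp_nondecreasing[of 0 1 \<phi>]) auto
  then show ?thesis
    by (simp add: \<phi>_def u_def)
qed

lemma grad_lipschitz:
  fixes f :: "'a::euclidean_space \<Rightarrow> real"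
  assumes f: "three_times_differentiable f"
    and L: "\<And>x u. norm (hess f x u) \<le> L * norm u"
  shows "norm (grad f x - grad f y) \<le> L * norm (x - y)"
proof (rule differentiable_bound[where S = UNIV and f' = "\<lambda>x. blinfun_apply (hess f x)"])
  show "(grad f has_derivative blinfun_apply (hess f x)) (at x within UNIV)" for x
    using f has_derivative_Blinfun_frechet[of "grad f" x]
    by (simp add: three_times_differentiable_def hess_def)
  show "onorm (blinfun_apply (hess f x)) \<le> L" for x
    using L by (rule onorm_le)
qed auto

text \<open>The third derivative exists but may be discontinuous, so two mean value inequalities
  along the segment replace the integral remainder; hence \<open>L\<close> instead of
  \<open>L / 2\<close>. Only the direction y - x enters, so the bound on the diagonal
  \<open>third_deriv f x u u\<close> is enough.\<close>

lemma grad_taylor: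
  fixes f :: "'a::euclidean_space \<Rightarrow> real"
  assumes f: "three_times_differentiable f"
    and L: "\<And>x u. norm (third_deriv f x u u) \<le> L * (norm u)\<^sup>2"
  shows "norm (grad f y - grad f x - hess f x (y - x)) \<le> L * (norm (y - x))\<^sup>2"
proof -
  define u where "u = y - x"
  define p where "p t = x + t *\<^sub>R u" for t :: real
  have p: "(p has_derivative (\<lambda>h. h *\<^sub>R u)) (at t within S)" for t S
    unfolding p_def[abs_def] by (auto intro!: derivative_eq_intros)
  have g: "(grad f has_derivative hess f z) (at z within S)"
    and h: "(hess f has_derivative third_deriv f z) (at z within S)" for z S
    using f has_derivative_Blinfun_frechet[of "grad f" z] has_derivative_Blinfun_frechet[of "hess f" z]
    by (auto simp: three_times_differentiable_def hess_def third_deriv_def intro: has_derivative_at_withinI)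
  have g1: "((\<lambda>t. grad f (p t)) has_vector_derivative hess f (p t) u) (at t within S)" for t S
    using has_derivative_in_compose[OF p g]
    by (simp add: has_vector_derivative_def blinfun.scaleR_right)
  have h1: "((\<lambda>t. hess f (p t) u) has_vector_derivative third_deriv f (p t) u u) (at t within S)" for t S
  proof -
    have "((\<lambda>t. hess f (p t)) has_derivative (\<lambda>h. third_deriv f (p t) (h *\<^sub>R u))) (at t within S)"
      by (rule has_derivative_in_compose[OF p h])
    then have "((\<lambda>t. hess f (p t) u) has_derivative (\<lambda>h. third_deriv f (p t) (h *\<^sub>R u) u)) (at t within S)"
      by (auto intro!: derivative_eq_intros)
    then show ?thesis
      by (simp add: has_vector_derivative_def blinfun.scaleR_right blinfun.scaleR_left)
  qed
  have b: "norm (hess f (p t) u - hess f (p 0) u) \<le> L * (norm u)\<^sup>2" if "t \<in> {0..1}" for t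
  proof -
    have "norm (hess f (p t) u - hess f (p 0) u) \<le> L * (norm u)\<^sup>2 * norm (t - 0)"
    proof (rule differentiable_bound[where S = "{0..1}" and f' = "\<lambda>t h. h *\<^sub>R third_deriv f (p t) u u"])
      show "onorm (\<lambda>h. h *\<^sub>R third_deriv f (p t) u u) \<le> L * (norm u)\<^sup>2" for t
      proof (rule onorm_le)
        show "norm (h *\<^sub>R third_deriv f (p t) u u) \<le> L * (norm u)\<^sup>2 * norm h" for h
          using L[of "p t" u] by (simp add: mult.commute mult_left_mono)
      qed
    qed (use h1 that in \<open>auto simp: has_vector_derivative_def\<close>)
    also have "\<dots> \<le> L * (norm u)\<^sup>2"
      using that order_trans[OF norm_ge_zero L[of x u]] by (auto intro: mult_left_le)
    finally show ?thesis .
  qed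
  have "norm (grad f (p 1) - grad f (p 0) - (1 - 0) *\<^sub>R hess f (p 0) u) \<le> norm (1 - 0 :: real) * (L * (norm u)\<^sup>2)"
    by (rule vector_differentiable_bound_linearization[where S = "{0..1}" and f' = "\<lambda>t. hess f (p t) u"])
      (use g1 b in \<open>auto simp: closed_segment_eq_real_ivl\<close>)
  then show ?thesis
    by (simp add: p_def u_def)
qed

subsection \<open>Integrals over kernels and products\<close>

text \<open>Tonelli: integrability under the composed law is a conclusion. This is how finite second
  moments pass through a kernel.\<close>

lemma integrable_bind_nonneg:
  fixes f :: "'b \<Rightarrow> real"
  assumes K: "K \<in> M \<rightarrow>\<^sub>M prob_algebra N" and f: "f \<in> borel_measurable N"
    and nn: "\<And>y. 0 \<le> f y"
    and int: "\<And>x. x \<in> space M \<Longrightarrow> integrable (K x) f"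
    and int2: "integrable M (\<lambda>x. \<integral>y. f y \<partial>K x)"
    and M: "space M \<noteq> {}"
  shows "integrable (M \<bind> K) f" "(\<integral>y. f y \<partial>(M \<bind> K)) = (\<integral>x. \<integral>y. f y \<partial>K x \<partial>M)"
proof -
  have "(\<integral>\<^sup>+y. ennreal (f y) \<partial>(M \<bind> K)) = (\<integral>\<^sup>+x. \<integral>\<^sup>+y. ennreal (f y) \<partial>K x \<partial>M)"
    using f K by (intro nn_integral_bind[where B = N]) (auto intro: measurable_prob_algebraD)
  also have "\<dots> = (\<integral>\<^sup>+x. ennreal (\<integral>y. f y \<partial>K x) \<partial>M)"
    using nn int by (intro nn_integral_cong nn_integral_eq_integral) auto
  also have "\<dots> = ennreal (\<integral>x. \<integral>y. f y \<partial>K x \<partial>M)"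
    using nn int2 by (intro nn_integral_eq_integral) (auto intro!: integral_nonneg_AE)
  finally have eq: "(\<integral>\<^sup>+y. ennreal (f y) \<partial>(M \<bind> K)) = ennreal (\<integral>x. \<integral>y. f y \<partial>K x \<partial>M)" .
  have "sets (M \<bind> K) = sets N"
    using M measurable_prob_algebraD[OF K] by (intro sets_bind_measurable) auto
  then have meas: "f \<in> borel_measurable (M \<bind> K)" using f by (simp cong: measurable_cong_sets)
  then show "integrable (M \<bind> K) f"
    using eq nn by (intro integrableI_nonneg) auto
  then show "(\<integral>y. f y \<partial>(M \<bind> K)) = (\<integral>x. \<integral>y. f y \<partial>K x \<partial>M)"
    using eq nn meas by (subst integral_eq_nn_integral) (auto intro!: integral_nonneg_AE)
qed

text \<open>Fubini for signed functions: integrability under the composed law is assumed, and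
  finiteness of both parts under almost every \<open>K x\<close> is derived from it.\<close>

lemma integral_bind_kernel_real:
  fixes f :: "'b \<Rightarrow> real"
  assumes K: "K \<in> M \<rightarrow>\<^sub>M prob_algebra N"
    and f: "integrable (M \<bind> K) f"
    and M: "space M \<noteq> {}"
  shows "integrable M (\<lambda>x. \<integral>y. f y \<partial>K x)"
    and "(\<integral>y. f y \<partial>(M \<bind> K)) = (\<integral>x. \<integral>y. f y \<partial>K x \<partial>M)"
proof -
  have sets: "sets (M \<bind> K) = sets N"
    using M measurable_prob_algebraD[OF K] by (intro sets_bind_measurable) auto
  have fm[measurable]: "f \<in> borel_measurable N"
    using borel_measurable_integrable[OF f] sets by (simp cong: measurable_cong_sets)
  have K'[measurable]: "K \<in> M \<rightarrow>\<^sub>M subprob_algebra N" using K by (rule measurable_prob_algebraD)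
  have *: "(\<integral>\<^sup>+y. h y \<partial>(M \<bind> K)) = (\<integral>\<^sup>+x. \<integral>\<^sup>+y. h y \<partial>K x \<partial>M)"
    if "h \<in> borel_measurable N" for h :: "'b \<Rightarrow> ennreal"
    using that K' by (rule nn_integral_bind)
  have p: "integrable M (\<lambda>x. enn2real (\<integral>\<^sup>+y. ennreal (h y) \<partial>K x)) \<and>
      enn2real (\<integral>\<^sup>+y. ennreal (h y) \<partial>(M \<bind> K)) = (\<integral>x. enn2real (\<integral>\<^sup>+y. ennreal (h y) \<partial>K x) \<partial>M)
      \<and> (AE x in M. (\<integral>\<^sup>+y. ennreal (h y) \<partial>K x) < \<infinity>)"
    if h: "integrable (M \<bind> K) h" and [measurable]: "h \<in> borel_measurable N" for h :: "'b \<Rightarrow> real"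
  proof -
    have mm[measurable]: "(\<lambda>x. \<integral>\<^sup>+y. ennreal (h y) \<partial>K x) \<in> borel_measurable M"
      by measurable
    have "(\<integral>\<^sup>+y. ennreal (h y) \<partial>(M \<bind> K)) \<le> (\<integral>\<^sup>+y. ennreal (norm (h y)) \<partial>(M \<bind> K))"
      by (intro nn_integral_mono) (auto intro: ennreal_leI)
    also have "\<dots> < \<infinity>" using h by (simp add: integrable_iff_bounded)
    finally have fin: "(\<integral>\<^sup>+x. \<integral>\<^sup>+y. ennreal (h y) \<partial>K x \<partial>M) < \<infinity>"
      by (simp add: *)
    then have ae: "AE x in M. (\<integral>\<^sup>+y. ennreal (h y) \<partial>K x) < \<infinity>"
      using nn_integral_PInf_AE[OF mm] by (auto simp: top.not_eq_extremum)
    have eq: "(\<integral>\<^sup>+x. ennreal (enn2real (\<integral>\<^sup>+y. ennreal (h y) \<partial>K x)) \<partial>M) = (\<integral>\<^sup>+x. \<integral>\<^sup>+y. ennreal (h y) \<partial>K x \<partial>M)"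
      using ae by (intro nn_integral_cong_AE) auto
    have "integrable M (\<lambda>x. enn2real (\<integral>\<^sup>+y. ennreal (h y) \<partial>K x))"
      using fin eq by (intro integrableI_nonneg) auto
    moreover have "(\<integral>x. enn2real (\<integral>\<^sup>+y. ennreal (h y) \<partial>K x) \<partial>M) = enn2real (\<integral>\<^sup>+x. \<integral>\<^sup>+y. ennreal (h y) \<partial>K x \<partial>M)"
      using eq by (subst integral_eq_nn_integral) auto
    ultimately show ?thesis using ae * by simp
  qed
  note p1 = p[OF f fm]
  have p2: "integrable M (\<lambda>x. enn2real (\<integral>\<^sup>+y. ennreal (- f y) \<partial>K x)) \<and>
      enn2real (\<integral>\<^sup>+y. ennreal (- f y) \<partial>(M \<bind> K)) = (\<integral>x. enn2real (\<integral>\<^sup>+y. ennreal (- f y) \<partial>K x) \<partial>M)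
      \<and> (AE x in M. (\<integral>\<^sup>+y. ennreal (- f y) \<partial>K x) < \<infinity>)"
    using f by (intro p) auto
  have m[measurable]: "(\<lambda>x. \<integral>y. f y \<partial>K x) \<in> borel_measurable M"
    by measurable
  have "AE x in M. x \<in> space M" by simp
  \<comment> \<open>\<open>enn2real\<close> sends infinity to 0 and a nonintegrable function has
    Bochner integral 0, so the difference formula is claimed only where both parts are
    finite.\<close>
  then have ae: "AE x in M. (\<integral>y. f y \<partial>K x) =
      enn2real (\<integral>\<^sup>+y. ennreal (f y) \<partial>K x) - enn2real (\<integral>\<^sup>+y. ennreal (- f y) \<partial>K x)"
    using conjunct2[OF conjunct2[OF p1]] conjunct2[OF conjunct2[OF p2]]
  proof eventually_elim
    case (elim x)
    have "sets (K x) = sets N" using K' elim(1) by (rule subprob_measurableD)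
    then have "f \<in> borel_measurable (K x)" using fm by (simp cong: measurable_cong_sets)
    then have "integrable (K x) f" using elim(2,3) by (simp add: real_integrable_def less_top)
    then show ?case by (rule real_lebesgue_integral_def)
  qed
  have i: "integrable M (\<lambda>x. enn2real (\<integral>\<^sup>+y. ennreal (f y) \<partial>K x) - enn2real (\<integral>\<^sup>+y. ennreal (- f y) \<partial>K x))"
    using p1 p2 by auto
  then show "integrable M (\<lambda>x. \<integral>y. f y \<partial>K x)"
    using ae by (subst integrable_cong_AE) auto
  have "(\<integral>x. \<integral>y. f y \<partial>K x \<partial>M) = (\<integral>x. enn2real (\<integral>\<^sup>+y. ennreal (f y) \<partial>K x) - enn2real (\<integral>\<^sup>+y. ennreal (- f y) \<partial>K x) \<partial>M)"
    using ae i by (intro integral_cong_AE) auto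
  also have "\<dots> = (\<integral>y. f y \<partial>(M \<bind> K))"
    using p1 p2 by (simp add: real_lebesgue_integral_def[OF f])
  finally show "(\<integral>y. f y \<partial>(M \<bind> K)) = (\<integral>x. \<integral>y. f y \<partial>K x \<partial>M)" by simp
qed

lemma integral_bind_kernel:
  fixes f :: "'b \<Rightarrow> 'c::euclidean_space"
  assumes K: "K \<in> M \<rightarrow>\<^sub>M prob_algebra N"
    and f: "integrable (M \<bind> K) f"
    and int: "\<And>x. x \<in> space M \<Longrightarrow> integrable (K x) f"
    and int2: "integrable M (\<lambda>x. \<integral>y. f y \<partial>K x)"
    and M: "space M \<noteq> {}"
  shows "(\<integral>y. f y \<partial>(M \<bind> K)) = (\<integral>x. \<integral>y. f y \<partial>K x \<partial>M)"
proof (rule euclidean_eqI)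
  fix b :: 'c assume "b \<in> Basis"
  have "inner (\<integral>y. f y \<partial>(M \<bind> K)) b = (\<integral>y. inner (f y) b \<partial>(M \<bind> K))"
    using f by simp
  also have "\<dots> = (\<integral>x. \<integral>y. inner (f y) b \<partial>K x \<partial>M)"
    using K f M by (intro integral_bind_kernel_real) auto
  also have "\<dots> = (\<integral>x. inner (\<integral>y. f y \<partial>K x) b \<partial>M)"
    using int by (intro Bochner_Integration.integral_cong) auto
  also have "\<dots> = inner (\<integral>x. \<integral>y. f y \<partial>K x \<partial>M) b"
    using int2 by simp
  finally show "inner (\<integral>y. f y \<partial>(M \<bind> K)) b = inner (\<integral>x. \<integral>y. f y \<partial>K x \<partial>M) b" .
qed

text \<open>Boxes form an intersection-stable generator, and the measure of a box is a finite
  product of measurable functions of \<open>x\<close>. This turns the independent runs of the agents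
  into one kernel.\<close>

lemma measurable_PiM_prob_algebra:
  assumes I: "finite I" and K: "\<And>i. i \<in> I \<Longrightarrow> K i \<in> M \<rightarrow>\<^sub>M prob_algebra (N i)"
  shows "(\<lambda>x. PiM I (\<lambda>i. K i x)) \<in> M \<rightarrow>\<^sub>M prob_algebra (PiM I N)"
proof (rule measurable_prob_algebra_generated[OF sets_PiM Int_stable_prod_algebra prod_algebra_sets_into_space])
  have K': "prob_space (K i x)" "sets (K i x) = sets (N i)" if "i \<in> I" "x \<in> space M" for i x
    using measurable_space[OF K[OF that(1)] that(2)] by (auto simp: space_prob_algebra)
  show "prob_space (PiM I (\<lambda>i. K i x))" if "x \<in> space M" for x
    using K' that by (intro prob_space_PiM) auto
  show "sets (PiM I (\<lambda>i. K i x)) = sets (PiM I N)" if "x \<in> space M" for x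
    using K' that by (intro sets_PiM_cong) auto
  fix A assume "A \<in> prod_algebra I N"
  then obtain X where A: "A = Pi\<^sub>E I X" and X: "\<And>i. i \<in> I \<Longrightarrow> X i \<in> sets (N i)"
    unfolding prod_algebra_eq_finite[OF I] by auto
  have eq: "emeasure (PiM I (\<lambda>i. K i x)) A = (\<Prod>i\<in>I. emeasure (K i x) (X i))" if x: "x \<in> space M" for x
  proof -
    have *: "sigma_finite_measure (K i x)" if "i \<in> I" for i
      using K'(1)[OF that x] by (simp add: prob_space_imp_sigma_finite)
    \<comment> \<open>The locale asks for sigma-finiteness at every index, so the family is padded
      outside \<open>I\<close>, which leaves the product over \<open>I\<close> unchanged.\<close>
    have "product_sigma_finite (\<lambda>i. if i \<in> I then K i x else count_space {})"
      by (rule product_sigma_finite.intro) (auto intro!: * sigma_finite_measure_count_space_finite)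
    then have "emeasure (PiM I (\<lambda>i. if i \<in> I then K i x else count_space {})) (Pi\<^sub>E I X) = (\<Prod>i\<in>I. emeasure (if i \<in> I then K i x else count_space {}) (X i))"
      using X K' x I by (intro product_sigma_finite.emeasure_PiM) auto
    also have "PiM I (\<lambda>i. if i \<in> I then K i x else count_space {}) = PiM I (\<lambda>i. K i x)"
      by (intro PiM_cong) auto
    finally show ?thesis by (simp add: A)
  qed
  have "(\<lambda>x. \<Prod>i\<in>I. emeasure (K i x) (X i)) \<in> borel_measurable M"
    using K X by (intro borel_measurable_prod_ennreal)
      (blast intro: measurable_compose[OF measurable_prob_algebraD measurable_emeasure_subprob_algebra])
  then show "(\<lambda>x. emeasure (PiM I (\<lambda>i. K i x)) A) \<in> borel_measurable M"
    using eq by (simp cong: measurable_cong)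
qed

subsection \<open>Mean and variance of vector-valued laws\<close>

text \<open>\<open>V\<close> is an upper bound for the variance, so it may be enlarged freely. The
  mean is a genuine integral and not the default value 0: square integrability around
  \<open>m\<close> implies integrability.\<close>

definition mean_var :: "'a::euclidean_space measure \<Rightarrow> 'a \<Rightarrow> real \<Rightarrow> bool" where
  "mean_var L m V \<longleftrightarrow> L \<in> space (prob_algebra borel) \<and> (\<integral>x. x \<partial>L) = m \<and>
     integrable L (\<lambda>x. (norm (x - m))\<^sup>2) \<and> (\<integral>x. (norm (x - m))\<^sup>2 \<partial>L) \<le> V"

lemma mean_varD:
  assumes "mean_var L m V"
  shows "prob_space L" "sets L = sets borel" "(\<integral>x. x \<partial>L) = m"
    "integrable L (\<lambda>x. (norm (x - m))\<^sup>2)" "(\<integral>x. (norm (x - m))\<^sup>2 \<partial>L) \<le> V"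
  using assms by (auto simp: mean_var_def space_prob_algebra)

context prob_space
begin

lemma integrable_of_square_dist:
  fixes X :: "'a \<Rightarrow> 'b::euclidean_space"
  assumes X: "X \<in> borel_measurable M" and "integrable M (\<lambda>x. (norm (X x - a))\<^sup>2)"
  shows "integrable M X"
proof -
  have "integrable M (\<lambda>x. 1 + norm a + (norm (X x - a))\<^sup>2)"
    using assms by auto
  then show ?thesis
  proof (rule Bochner_Integration.integrable_bound[OF _ X], intro AE_I2)
    fix x
    have "norm (X x) \<le> norm a + norm (X x - a)"
      by norm
    also have "norm (X x - a) \<le> 1 + (norm (X x - a))\<^sup>2"
      using zero_le_power2[of "norm (X x - a) - 1"] by (simp add: power2_diff) (smt (verit) norm_ge_zero)
    finally show "norm (X x) \<le> norm (1 + norm a + (norm (X x - a))\<^sup>2)"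
      by simp
  qed
qed

text \<open>Expansion around the expectation, whose cross term integrates to 0. The centre
  \<open>b\<close> is free because square integrability around one point gives it around every
  point.\<close>

lemma bias_variance:
  fixes X :: "'a \<Rightarrow> 'b::euclidean_space"
  assumes X: "X \<in> borel_measurable M" and int: "integrable M (\<lambda>x. (norm (X x - b))\<^sup>2)"
  shows "integrable M (\<lambda>x. (norm (X x - a))\<^sup>2)"
    and "expectation (\<lambda>x. (norm (X x - a))\<^sup>2) =
      (norm (expectation X - a))\<^sup>2 + expectation (\<lambda>x. (norm (X x - expectation X))\<^sup>2)"
proof -
  have iX: "integrable M X" by (rule integrable_of_square_dist[OF assms])
  have eq: "(norm (X x - a))\<^sup>2 = (norm (X x - b))\<^sup>2 + 2 * inner (X x - b) (b - a) + (norm (b - a))\<^sup>2" for a b x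
    by (simp add: power2_norm_eq_inner algebra_simps inner_commute)
  have i: "integrable M (\<lambda>x. (norm (X x - a))\<^sup>2)" for a
    unfolding eq[of _ a b] using int iX by auto
  show "integrable M (\<lambda>x. (norm (X x - a))\<^sup>2)" by (rule i)
  show "expectation (\<lambda>x. (norm (X x - a))\<^sup>2) =
      (norm (expectation X - a))\<^sup>2 + expectation (\<lambda>x. (norm (X x - expectation X))\<^sup>2)"
    unfolding eq[of _ a "expectation X"] using i iX by (simp add: prob_space)
qed

lemma variance_minimal:
  fixes X :: "'a \<Rightarrow> 'b::euclidean_space"
  assumes "X \<in> borel_measurable M" "integrable M (\<lambda>x. (norm (X x - a))\<^sup>2)"
  shows "expectation (\<lambda>x. (norm (X x - expectation X))\<^sup>2) \<le> expectation (\<lambda>x. (norm (X x - a))\<^sup>2)"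
  using bias_variance(2)[OF assms, of a] by simp

end

lemma mean_var_return: "mean_var (return borel x) x 0"
proof -
  have "integrable (return borel x) (\<lambda>y. (norm (y - x))\<^sup>2)"
    by (intro integrableI_bounded) (auto simp: nn_integral_return)
  then show ?thesis
    by (simp add: mean_var_def space_prob_algebra prob_space_return integral_return)
qed

lemma mean_var_integrable:
  assumes "mean_var L m V"
  shows "integrable L (\<lambda>x. x)"
proof -
  interpret prob_space L using mean_varD[OF assms] by simp
  show ?thesis using mean_varD[OF assms]
    by (intro integrable_of_square_dist[where a = m]) auto
qed

text \<open>The spread of \<open>k\<close> is measured around \<open>k m\<close>, which may differ
  from the mean of \<open>k\<close>; passing to the mean only lowers it, by
  \<open>variance_minimal\<close>.\<close>

lemma mean_var_lipschitz:
  fixes k :: "'a::euclidean_space \<Rightarrow> 'b::euclidean_space"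
  assumes L: "mean_var L m V" and k: "\<And>x y. norm (k x - k y) \<le> A * norm (x - y)"
  shows "k \<in> borel_measurable borel" "integrable L k"
    "integrable L (\<lambda>x. (norm (k x - k m))\<^sup>2)" "(\<integral>x. (norm (k x - k m))\<^sup>2 \<partial>L) \<le> A\<^sup>2 * V"
proof -
  note D = mean_varD[OF L]
  interpret prob_space L by (rule D)
  \<comment> \<open>\<open>lipschitz_on\<close> requires a nonnegative constant, which is not
    assumed of \<open>A\<close>.\<close>
  have "(max A 0)-lipschitz_on UNIV k"
    by (intro lipschitz_onI) (auto simp: dist_norm intro!: order_trans[OF k] mult_right_mono)
  then show "k \<in> borel_measurable borel"
    by (intro borel_measurable_continuous_onI lipschitz_on_continuous_on)
  then have km: "k \<in> borel_measurable L" using D by simp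
  have b: "(norm (k x - k m))\<^sup>2 \<le> A\<^sup>2 * (norm (x - m))\<^sup>2" for x
    using power_mono[OF k[of x m], of 2] by (simp add: power_mult_distrib)
  have i: "integrable L (\<lambda>x. A\<^sup>2 * (norm (x - m))\<^sup>2)" using D by simp
  show i2: "integrable L (\<lambda>x. (norm (k x - k m))\<^sup>2)"
    by (rule Bochner_Integration.integrable_bound[OF i]) (use km b in auto)
  show "integrable L k"
    by (rule integrable_of_square_dist[OF km i2])
  have "(\<integral>x. (norm (k x - k m))\<^sup>2 \<partial>L) \<le> (\<integral>x. A\<^sup>2 * (norm (x - m))\<^sup>2 \<partial>L)"
    using i i2 b by (intro integral_mono) auto
  also have "\<dots> \<le> A\<^sup>2 * V" using D by (simp add: mult_left_mono)
  finally show "(\<integral>x. (norm (k x - k m))\<^sup>2 \<partial>L) \<le> A\<^sup>2 * V" .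
qed

text \<open>Law of total variance: the conditional variance contributes at most \<open>s\<close>,
  the fluctuation of the conditional mean \<open>k\<close> at most \<open>A\<^sup>2 * V\<close>. It
  propagates one local step.\<close>

lemma mean_var_bind:
  fixes L :: "'a::euclidean_space measure" and k :: "'a \<Rightarrow> 'b::euclidean_space"
  assumes L: "mean_var L m V" and K: "K \<in> borel \<rightarrow>\<^sub>M prob_algebra borel"
    and Kk: "\<And>x. mean_var (K x) (k x) s"
    and k: "\<And>x y. norm (k x - k y) \<le> A * norm (x - y)"
  shows "mean_var (L \<bind> K) (\<integral>x. k x \<partial>L) (A\<^sup>2 * V + s)"
proof -
  note D = mean_varD[OF L] and kD = mean_var_lipschitz[OF L k]
  interpret L: prob_space L by (rule D)
  define m' where "m' = (\<integral>x. k x \<partial>L)"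
  have KL: "K \<in> L \<rightarrow>\<^sub>M prob_algebra borel" using K D by (simp cong: measurable_cong_sets)
  have km: "k \<in> borel_measurable L" using kD D by simp
  have Kx: "integrable (K x) (\<lambda>y. (norm (y - m'))\<^sup>2) \<and>
      (\<integral>y. (norm (y - m'))\<^sup>2 \<partial>K x) \<le> (norm (k x - m'))\<^sup>2 + s" for x
  proof -
    note Dx = mean_varD[OF Kk[of x]]
    interpret Kx: prob_space "K x" by (rule Dx)
    have "(\<lambda>y. y) \<in> borel_measurable (K x)" using Dx by simp
    from Kx.bias_variance[OF this Dx(4), of m'] Dx show ?thesis by simp
  qed
  have ik: "integrable L (\<lambda>x. (norm (k x - m'))\<^sup>2 + s)"
    using L.bias_variance(1)[OF km kD(3)] by simp
  have meas: "(\<lambda>x. \<integral>y. (norm (y - m'))\<^sup>2 \<partial>K x) \<in> borel_measurable L"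
    using measurable_prob_algebraD[OF KL] by measurable
  \<comment> \<open>Domination by the bound of \<open>Kx\<close>; the Tonelli lemma needs this
    integrability as an input.\<close>
  have iK: "integrable L (\<lambda>x. \<integral>y. (norm (y - m'))\<^sup>2 \<partial>K x)"
    by (rule Bochner_Integration.integrable_bound[OF ik meas])
      (use Kx in \<open>auto intro!: AE_I2 abs_leI order_trans[OF _ abs_ge_self] simp: integral_nonneg_AE abs_of_nonneg\<close>)
  have b: "integrable (L \<bind> K) (\<lambda>y. (norm (y - m'))\<^sup>2)"
    "(\<integral>y. (norm (y - m'))\<^sup>2 \<partial>(L \<bind> K)) = (\<integral>x. \<integral>y. (norm (y - m'))\<^sup>2 \<partial>K x \<partial>L)"
    using integrable_bind_nonneg[OF KL _ _ _ iK L.not_empty] Kx by auto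
  have "(\<integral>y. (norm (y - m'))\<^sup>2 \<partial>(L \<bind> K)) \<le> (\<integral>x. (norm (k x - m'))\<^sup>2 + s \<partial>L)"
    unfolding b using iK ik Kx by (intro integral_mono) auto
  also have "\<dots> = (\<integral>x. (norm (k x - m'))\<^sup>2 \<partial>L) + s"
    using L.bias_variance(1)[OF km kD(3)] by (simp add: L.prob_space)
  also have "(\<integral>x. (norm (k x - m'))\<^sup>2 \<partial>L) \<le> (\<integral>x. (norm (k x - k m))\<^sup>2 \<partial>L)"
    unfolding m'_def by (rule L.variance_minimal[OF km kD(3)])
  also have "\<dots> \<le> A\<^sup>2 * V" by (rule kD)
  finally have v: "(\<integral>y. (norm (y - m'))\<^sup>2 \<partial>(L \<bind> K)) \<le> A\<^sup>2 * V + s" by simp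
  have "L \<in> space (prob_algebra borel)" using L by (simp add: mean_var_def)
  then have pr: "prob_space (L \<bind> K)" "sets (L \<bind> K) = sets borel"
    using K prob_space_bind' sets_bind' by blast+
  interpret LK: prob_space "L \<bind> K" by (rule pr)
  have "integrable (L \<bind> K) (\<lambda>y. y)"
    using pr by (intro LK.integrable_of_square_dist[OF _ b(1)]) (simp cong: measurable_cong_sets)
  then have "(\<integral>y. y \<partial>(L \<bind> K)) = (\<integral>x. \<integral>y. y \<partial>K x \<partial>L)"
    using mean_var_integrable[OF Kk] kD(2) mean_varD(3)[OF Kk]
    by (intro integral_bind_kernel[OF KL _ _ _ L.not_empty]) auto
  then have "(\<integral>y. y \<partial>(L \<bind> K)) = m'"
    using mean_varD(3)[OF Kk] by (simp add: m'_def)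
  then show ?thesis
    using pr b v unfolding m'_def[symmetric] by (simp add: mean_var_def space_prob_algebra)
qed


text \<open>Distinct components are independent and centred, so only the diagonal of the double sum
  for the squared norm survives: \<open>M\<close> terms of size at most \<open>V\<close>, divided by
  \<open>M\<^sup>2\<close>.\<close>

lemma mean_var_avg:
  fixes L :: "nat \<Rightarrow> 'a::euclidean_space measure"
  assumes M: "1 \<le> M" and L: "\<And>c. c \<in> {1..M} \<Longrightarrow> mean_var (L c) (m c) V"
  shows "mean_var (distr (PiM {1..M} L) borel (avg M)) (avg M m) (V / real M)"
proof -
  let ?I = "{1..M}" and ?P = "PiM {1..M} L"
  note D = mean_varD[OF L]
  interpret P: prob_space ?P using D by (intro prob_space_PiM) auto
  define L' where "L' c = (if c \<in> ?I then L c else return borel 0)" for c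
  have PL': "?P = PiM ?I L'"
    by (intro PiM_cong) (auto simp: L'_def)
  have "prob_space (L' c)" for c
    using D by (auto simp: L'_def prob_space_return)
  then interpret L': product_sigma_finite L'
    by (auto intro!: product_sigma_finite.intro prob_space_imp_sigma_finite)
  have comp[measurable]: "(\<lambda>x. x c) \<in> ?P \<rightarrow>\<^sub>M borel" if "c \<in> ?I" for c
    using measurable_component_singleton[OF that, of L] D[OF that] by (simp cong: measurable_cong_sets)
  have dist: "distr ?P (L c) (\<lambda>x. x c) = L c" if "c \<in> ?I" for c
    using D that by (intro distr_PiM_component) auto
  have ci: "integrable (L c) h \<longleftrightarrow> integrable ?P (\<lambda>x. h (x c))"
    and ce: "(\<integral>y. h y \<partial>L c) = (\<integral>x. h (x c) \<partial>?P)"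
    if "c \<in> ?I" "h \<in> borel_measurable borel" for c and h :: "'a \<Rightarrow> 'b::{banach, second_countable_topology}"
  proof -
    have h: "h \<in> borel_measurable (L c)" "(\<lambda>x. x c) \<in> ?P \<rightarrow>\<^sub>M L c"
      using that(2) measurable_cong_sets[OF D(2)[OF that(1)] refl]
        measurable_component_singleton[OF that(1), of L] by auto
    show "integrable (L c) h \<longleftrightarrow> integrable ?P (\<lambda>x. h (x c))"
      by (subst dist[OF that(1), symmetric], rule integrable_distr_eq) (use h in auto)
    show "(\<integral>y. h y \<partial>L c) = (\<integral>x. h (x c) \<partial>?P)"
      by (subst dist[OF that(1), symmetric], rule integral_distr) (use h in auto)
  qed
  define X where "X c x = x c - m c" for c and x :: "nat \<Rightarrow> 'a"
  have sq: "integrable ?P (\<lambda>x. (norm (X c x))\<^sup>2)" "(\<integral>x. (norm (X c x))\<^sup>2 \<partial>?P) \<le> V" if "c \<in> ?I" for c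
    using ci[OF that, of "\<lambda>y. (norm (y - m c))\<^sup>2"] ce[OF that, of "\<lambda>y. (norm (y - m c))\<^sup>2"] D[OF that]
    by (auto simp: X_def)
  have id: "integrable ?P (\<lambda>x. x c)" "(\<integral>x. x c \<partial>?P) = m c" if "c \<in> ?I" for c
  proof -
    show "integrable ?P (\<lambda>x. x c)"
      by (rule iffD1[OF ci[OF that] mean_var_integrable[OF L[OF that]]]) simp
    show "(\<integral>x. x c \<partial>?P) = m c"
      using ce[OF that, of "\<lambda>y. y"] D(3)[OF that] by simp
  qed
  have cross: "integrable ?P (\<lambda>x. inner (X c x) (X d x)) \<and> (\<integral>x. inner (X c x) (X d x) \<partial>?P) = 0"
    if cd: "c \<in> ?I" "d \<in> ?I" "c \<noteq> d" for c d
  proof -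
    have "integrable ?P (\<lambda>x. inner (X c x) b * inner (X d x) b) \<and>
        (\<integral>x. inner (X c x) b * inner (X d x) b \<partial>?P) = 0" for b
    proof -
      \<comment> \<open>The product rule for integrals is scalar, so the inner product is treated
        coordinate by coordinate; the factor 1 at the other indices makes the pair a product over
        all agents.\<close>
      define h where "h i y = (if i = c then inner (y - m c) b else if i = d then inner (y - m d) b else 1)"
        for i :: nat and y
      have hc: "integrable (L' i) (h i)" if "i \<in> ?I" for i
      proof -
        interpret Li: prob_space "L i" by (rule D[OF that])
        have "integrable (L i) (\<lambda>y. inner (y - a) b)" for a
          using mean_var_integrable[OF L[OF that]] by simp
        then have "integrable (L i) (h i)"
          by (cases "i = c"; cases "i = d") (simp_all add: h_def[abs_def])
        then show ?thesis using that by (simp add: L'_def)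
      qed
      have "(\<integral>y. h c y \<partial>L' c) = 0"
      proof -
        interpret Lc: prob_space "L c" by (rule D[OF cd(1)])
        show ?thesis
          using cd mean_var_integrable[OF L[OF cd(1)]] D(3)[OF cd(1)]
          by (simp add: h_def[abs_def] L'_def Lc.prob_space inner_diff_left)
      qed
      then have z: "(\<Prod>i\<in>?I. \<integral>y. h i y \<partial>L' i) = 0"
        using cd by (intro prod_zero) auto
      have pr: "(\<Prod>i\<in>?I. h i (x i)) = inner (X c x) b * inner (X d x) b" for x
      proof -
        have "(\<Prod>i\<in>?I. h i (x i)) = (\<Prod>i\<in>{c, d}. h i (x i))"
          using cd by (intro prod.mono_neutral_right) (auto simp: h_def)
        then show ?thesis using cd by (simp add: h_def X_def)
      qed
      show ?thesis
        unfolding pr[symmetric] PL'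
        using L'.product_integrable_prod[of ?I h, OF _ hc] L'.product_integral_prod[of ?I h, OF _ hc] z
        by auto
    qed
    moreover have "inner (X c x) (X d x) = (\<Sum>b\<in>Basis. inner (X c x) b * inner (X d x) b)" for x
      by (rule euclidean_inner)
    ultimately show ?thesis by (simp add: Bochner_Integration.integral_sum)
  qed
  define A where "A x = avg M x - avg M m" for x :: "nat \<Rightarrow> 'a"
  have Aeq: "A x = (1 / real M) *\<^sub>R (\<Sum>c\<in>?I. X c x)" for x
    by (simp add: A_def avg_def X_def sum_subtractf scaleR_diff_right)
  have nA: "(norm (A x))\<^sup>2 = (\<Sum>c\<in>?I. \<Sum>d\<in>?I. inner (X c x) (X d x)) / (real M)\<^sup>2" for x
  proof -
    have "(norm (A x))\<^sup>2 = inner (\<Sum>c\<in>?I. X c x) (\<Sum>d\<in>?I. X d x) / (real M)\<^sup>2"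
      unfolding Aeq power2_norm_eq_inner by (simp add: power2_eq_square)
    then show ?thesis by (simp only: inner_sum_left) (simp add: inner_sum_right)
  qed
  have dbl: "integrable ?P (\<lambda>x. inner (X c x) (X d x))" if "c \<in> ?I" "d \<in> ?I" for c d
    using that cross sq(1) by (cases "c = d") (auto simp: power2_norm_eq_inner)
  have iA: "integrable ?P (\<lambda>x. (norm (A x))\<^sup>2)"
    unfolding nA by (intro integrable_divide Bochner_Integration.integrable_sum dbl)
  have "(\<integral>x. (norm (A x))\<^sup>2 \<partial>?P) = (\<integral>x. (\<Sum>c\<in>?I. \<Sum>d\<in>?I. inner (X c x) (X d x)) \<partial>?P) / (real M)\<^sup>2"
    unfolding nA by (rule integral_divide_zero)
  also have "(\<integral>x. (\<Sum>c\<in>?I. \<Sum>d\<in>?I. inner (X c x) (X d x)) \<partial>?P) =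
      (\<Sum>c\<in>?I. \<integral>x. (\<Sum>d\<in>?I. inner (X c x) (X d x)) \<partial>?P)"
    by (intro Bochner_Integration.integral_sum Bochner_Integration.integrable_sum dbl)
  also have "\<dots> = (\<Sum>c\<in>?I. \<Sum>d\<in>?I. \<integral>x. inner (X c x) (X d x) \<partial>?P)"
    by (intro sum.cong refl Bochner_Integration.integral_sum dbl)
  finally have eA: "(\<integral>x. (norm (A x))\<^sup>2 \<partial>?P) = (\<Sum>c\<in>?I. \<Sum>d\<in>?I. \<integral>x. inner (X c x) (X d x) \<partial>?P) / (real M)\<^sup>2" .
  have "(\<Sum>d\<in>?I. \<integral>x. inner (X c x) (X d x) \<partial>?P) \<le> V" if c: "c \<in> ?I" for c
  proof -
    have "(\<Sum>d\<in>?I. \<integral>x. inner (X c x) (X d x) \<partial>?P) = (\<Sum>d\<in>{c}. \<integral>x. inner (X c x) (X d x) \<partial>?P)"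
      using c cross by (intro sum.mono_neutral_right) auto
    then show ?thesis using sq(2)[OF c] by (simp add: power2_norm_eq_inner)
  qed
  then have "(\<Sum>c\<in>?I. \<Sum>d\<in>?I. \<integral>x. inner (X c x) (X d x) \<partial>?P) \<le> real M * V"
    using sum_bounded_above[of ?I _ V] by simp
  then have vA: "(\<integral>x. (norm (A x))\<^sup>2 \<partial>?P) \<le> V / real M"
    using M unfolding eA by (simp add: divide_simps power2_eq_square mult.commute[of V])
  have am[measurable]: "avg M \<in> ?P \<rightarrow>\<^sub>M borel"
    unfolding avg_def[abs_def] by measurable
  have mean: "(\<integral>x. avg M x \<partial>?P) = avg M m"
    unfolding avg_def using id
    by (subst integral_scaleR_right, subst Bochner_Integration.integral_sum) auto
  show ?thesis
    using P.prob_space_distr[OF am] iA vA mean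
    by (simp add: mean_var_def space_prob_algebra integrable_distr_eq[OF am] integral_distr[OF am] A_def
        del: One_nat_def)
qed

text \<open>One induction carries two bounds. If the displacement grows by at most 6/5 K per unit of
  \<open>\<eta> * h\<close>, then \<open>G\<close> moves by at most 1/6 * 6/5 K = K/5, and 1 + 1/5 =
  6/5 reproduces the displacement bound; the second bound accumulates the deviations b + K/5 from
  the initial gradient.\<close>

lemma perturbed_gradient_steps:
  fixes G :: "'a::real_normed_vector \<Rightarrow> 'a"
  assumes L: "\<And>x y. norm (G x - G y) \<le> L * norm (x - y)" and "0 \<le> L" "0 \<le> b" "0 \<le> \<eta>"
    and step: "\<And>h. h < H \<Longrightarrow> norm (m (Suc h) - m h - \<eta> *\<^sub>R G (m h)) \<le> \<eta> * b"
    and small: "\<eta> * real H * L \<le> 1 / 6"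
  shows "norm (m H - m 0 - (\<eta> * real H) *\<^sub>R G (m 0)) \<le> \<eta> * real H * (b + (norm (G (m 0)) + b) / 5)"
proof -
  define K where "K = norm (G (m 0)) + b"
  have "0 \<le> K" using \<open>0 \<le> b\<close> by (simp add: K_def)
  have "norm (m h - m 0) \<le> 6 / 5 * \<eta> * real h * K \<and>
      norm (m h - m 0 - (\<eta> * real h) *\<^sub>R G (m 0)) \<le> \<eta> * real h * (b + K / 5)"
    if "h \<le> H" for h
    using that
  proof (induction h)
    case 0
    then show ?case by simp
  next
    case (Suc h)
    then have IH: "norm (m h - m 0) \<le> 6 / 5 * \<eta> * real h * K"
      "norm (m h - m 0 - (\<eta> * real h) *\<^sub>R G (m 0)) \<le> \<eta> * real h * (b + K / 5)" by auto
    have "\<eta> * L * real h \<le> \<eta> * L * real H"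
      using Suc.prems assms by (intro mult_left_mono) auto
    then have hL: "\<eta> * L * real h \<le> 1 / 6" using small by (simp add: mult.commute mult.left_commute)
    have "norm (G (m h) - G (m 0)) \<le> L * (6 / 5 * \<eta> * real h * K)"
      using L[of "m h" "m 0"] IH(1) \<open>0 \<le> L\<close> by (meson mult_left_mono order_trans)
    also have "\<dots> = (\<eta> * L * real h) * (6 / 5 * K)" by simp
    also have "\<dots> \<le> 1 / 6 * (6 / 5 * K)"
      using hL \<open>0 \<le> K\<close> by (intro mult_right_mono) auto
    finally have d: "norm (G (m h) - G (m 0)) \<le> K / 5" by simp
    define r where "r = m (Suc h) - m h - \<eta> *\<^sub>R G (m h)"
    define q where "q = r + \<eta> *\<^sub>R (G (m h) - G (m 0))"
    have "norm q \<le> norm r + \<eta> * norm (G (m h) - G (m 0))"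
      using \<open>0 \<le> \<eta>\<close> unfolding q_def by (metis abs_of_nonneg norm_scaleR norm_triangle_ineq)
    also have "\<dots> \<le> \<eta> * b + \<eta> * (K / 5)"
      using step[of h] Suc.prems d \<open>0 \<le> \<eta>\<close> unfolding r_def by (intro add_mono mult_left_mono) auto
    finally have q: "norm q \<le> \<eta> * (b + K / 5)" by (simp add: distrib_left)
    have "m (Suc h) - m 0 = (m h - m 0) + (q + \<eta> *\<^sub>R G (m 0))"
      by (simp add: q_def r_def algebra_simps)
    then have "norm (m (Suc h) - m 0) \<le> norm (m h - m 0) + (norm q + \<eta> * norm (G (m 0)))"
      using \<open>0 \<le> \<eta>\<close> by (metis abs_of_nonneg norm_scaleR norm_triangle_le add_left_mono norm_triangle_ineq)
    also have "\<dots> \<le> 6 / 5 * \<eta> * real h * K + (\<eta> * (b + K / 5) + \<eta> * norm (G (m 0)))"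
      using IH(1) q by simp
    also have "\<dots> = 6 / 5 * \<eta> * real (Suc h) * K"
      by (simp add: K_def field_simps)
    finally have 1: "norm (m (Suc h) - m 0) \<le> 6 / 5 * \<eta> * real (Suc h) * K" .
    have "m (Suc h) - m 0 - (\<eta> * real (Suc h)) *\<^sub>R G (m 0) = (m h - m 0 - (\<eta> * real h) *\<^sub>R G (m 0)) + q"
      by (simp add: q_def r_def algebra_simps)
    then have "norm (m (Suc h) - m 0 - (\<eta> * real (Suc h)) *\<^sub>R G (m 0)) \<le> \<eta> * real h * (b + K / 5) + \<eta> * (b + K / 5)"
      using IH(2) q by (metis add_mono norm_triangle_le)
    then show ?case using 1 by (simp add: algebra_simps add_divide_distrib)
  qed
  then show ?thesis by (simp add: K_def)
qed

text \<open>Jensen for the square, read off from the nonnegative variance of the squared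
  variable.\<close>

lemma (in prob_space) integral_square_le_of_fourth_moment:
  fixes X :: "'a \<Rightarrow> real"
  assumes X: "X \<in> borel_measurable M"
    and 4: "(\<integral>\<^sup>+x. ennreal (X x ^ 4) \<partial>M) \<le> ennreal (s ^ 4)"
    and 2: "integrable M (\<lambda>x. (X x)\<^sup>2)"
  shows "expectation (\<lambda>x. (X x)\<^sup>2) \<le> s\<^sup>2"
proof -
  define e where "e = expectation (\<lambda>x. (X x)\<^sup>2)"
  have i4: "integrable M (\<lambda>x. X x ^ 4)"
    using X 4 by (intro integrableI_nonneg) (auto intro: le_less_trans)
  have "0 \<le> expectation (\<lambda>x. ((X x)\<^sup>2 - e)\<^sup>2)"
    by (intro integral_nonneg_AE) auto
  also have "(\<lambda>x. ((X x)\<^sup>2 - e)\<^sup>2) = (\<lambda>x. X x ^ 4 - 2 * e * (X x)\<^sup>2 + e\<^sup>2)"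
    by (simp add: power2_eq_square power4_eq_xxxx algebra_simps)
  also have "expectation (\<lambda>x. X x ^ 4 - 2 * e * (X x)\<^sup>2 + e\<^sup>2) = expectation (\<lambda>x. X x ^ 4) - 2 * e * e + e\<^sup>2"
    using i4 2 by (simp add: prob_space e_def)
  finally have "e\<^sup>2 \<le> expectation (\<lambda>x. X x ^ 4)" by (simp add: power2_eq_square)
  also have "\<dots> \<le> s ^ 4"
    using 4 i4 by (subst (asm) nn_integral_eq_integral) (auto simp: ennreal_le_iff)
  finally have "e\<^sup>2 \<le> (s\<^sup>2)\<^sup>2" by simp
  then show ?thesis unfolding e_def[symmetric]
    by (rule power2_le_imp_le) simp
qed

subsection \<open>The local iterations of one agent\<close>

locale local_agent =
  fixes f :: "'a::euclidean_space \<Rightarrow> real" and Zs :: "'z measure" and \<xi> :: "'a \<Rightarrow> 'z measure"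
    and g :: "'z \<Rightarrow> 'a \<Rightarrow> 'a" and gbar :: "'a \<Rightarrow> 'a" and L2 L3 \<beta> \<sigma>2 \<sigma>4 \<eta> :: real and H :: nat
  assumes f3: "three_times_differentiable f"
    and \<xi>: "\<xi> \<in> borel \<rightarrow>\<^sub>M prob_algebra Zs"
    and g: "(\<lambda>(z, \<theta>). g z \<theta>) \<in> borel_measurable (Zs \<Otimes>\<^sub>M borel)"
    and gint: "\<And>\<theta>. integrable (\<xi> \<theta>) (\<lambda>z. g z \<theta>)"
    and gbar: "gbar = mean_grad \<xi> g"
    and nonneg: "0 < L2" "0 \<le> L3" "0 \<le> \<beta>"
    and hess: "\<And>\<theta> u. norm (hess f \<theta> u) \<le> L2 * norm u"
    and glip: "\<And>\<theta> \<theta>'. norm (gbar \<theta> - gbar \<theta>') \<le> L2 * norm (\<theta> - \<theta>')"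
    and third: "\<And>\<theta> u. norm (third_deriv f \<theta> u u) \<le> L3 * (norm u)\<^sup>2"
    and bias: "\<And>\<theta>. norm (grad f \<theta> - gbar \<theta>) \<le> \<beta>"
    and noise2: "\<And>\<theta>. (\<integral>\<^sup>+z. ennreal (norm (g z \<theta> - gbar \<theta>) ^ 2) \<partial>\<xi> \<theta>) \<le> ennreal (\<sigma>2 ^ 2)"
    and noise4: "\<And>\<theta>. (\<integral>\<^sup>+z. ennreal (norm (g z \<theta> - gbar \<theta>) ^ 4) \<partial>\<xi> \<theta>) \<le> ennreal (\<sigma>4 ^ 4)"
    and \<eta>: "0 < \<eta>" "\<eta> * real H * L2 \<le> 1 / 6"
begin

lemma sampler: "prob_space (\<xi> \<theta>)" "sets (\<xi> \<theta>) = sets Zs"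
  using measurable_space[OF \<xi>, of \<theta>] by (auto simp: space_prob_algebra)

lemma g_measurable: "(\<lambda>z. g z \<theta>) \<in> borel_measurable (\<xi> \<theta>)"
  using borel_measurable_integrable[OF gint] .

text \<open>The minimum keeps both bounds: \<open>\<sigma>2\<close> serves the variance of the
  averaged iterate, \<open>\<sigma>4\<close> the Taylor bias.\<close>

lemma noise_variance:
  "integrable (\<xi> \<theta>) (\<lambda>z. (norm (g z \<theta> - gbar \<theta>))\<^sup>2)"
  "(\<integral>z. (norm (g z \<theta> - gbar \<theta>))\<^sup>2 \<partial>\<xi> \<theta>) \<le> min (\<sigma>2\<^sup>2) (\<sigma>4\<^sup>2)"
proof -
  interpret prob_space "\<xi> \<theta>" by (rule sampler)
  have m: "(\<lambda>z. norm (g z \<theta> - gbar \<theta>)) \<in> borel_measurable (\<xi> \<theta>)"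
    using g_measurable[of \<theta>] by simp
  show i: "integrable (\<xi> \<theta>) (\<lambda>z. (norm (g z \<theta> - gbar \<theta>))\<^sup>2)"
    using m noise2[of \<theta>] by (intro integrableI_nonneg) (auto intro: le_less_trans)
  have "(\<integral>z. (norm (g z \<theta> - gbar \<theta>))\<^sup>2 \<partial>\<xi> \<theta>) \<le> \<sigma>2\<^sup>2"
    using noise2[of \<theta>] i by (subst (asm) nn_integral_eq_integral) (auto simp: ennreal_le_iff)
  then show "(\<integral>z. (norm (g z \<theta> - gbar \<theta>))\<^sup>2 \<partial>\<xi> \<theta>) \<le> min (\<sigma>2\<^sup>2) (\<sigma>4\<^sup>2)"
    using integral_square_le_of_fourth_moment[OF m noise4 i] by simp
qed

definition local_step :: "'a \<Rightarrow> 'a measure" where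
  "local_step x = \<xi> x \<bind> (\<lambda>z. return borel (x + \<eta> *\<^sub>R g z x))"

lemma local_step_measurable: "local_step \<in> borel \<rightarrow>\<^sub>M prob_algebra borel"
proof -
  have [measurable]: "(\<lambda>(x, z). g z x) \<in> borel_measurable (borel \<Otimes>\<^sub>M Zs)"
    using measurable_compose[OF measurable_pair_swap' g] by (simp add: case_prod_beta')
  have "(\<lambda>(x, z). x + \<eta> *\<^sub>R g z x) \<in> borel_measurable (borel \<Otimes>\<^sub>M Zs)"
    by measurable
  from measurable_compose[OF this measurable_return_prob_space]
  have "(\<lambda>(x, z). return borel (x + \<eta> *\<^sub>R g z x)) \<in> borel \<Otimes>\<^sub>M Zs \<rightarrow>\<^sub>M prob_algebra borel"
    by (simp add: case_prod_beta')
  then show ?thesis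
    unfolding local_step_def[abs_def] by (rule measurable_bind_prob_space2[OF \<xi>])
qed

lemma local_step_mean_var:
  "mean_var (local_step x) (x + \<eta> *\<^sub>R gbar x) (\<eta>\<^sup>2 * min (\<sigma>2\<^sup>2) (\<sigma>4\<^sup>2))"
proof -
  interpret prob_space "\<xi> x" by (rule sampler)
  have m: "(\<lambda>z. x + \<eta> *\<^sub>R g z x) \<in> borel_measurable (\<xi> x)"
    using g_measurable[of x] by simp
  have eq: "local_step x = distr (\<xi> x) borel (\<lambda>z. x + \<eta> *\<^sub>R g z x)"
    unfolding local_step_def using m not_empty by (rule bind_return_distr'[rotated])
  have dev: "(norm (\<eta> *\<^sub>R g z x - \<eta> *\<^sub>R gbar x))\<^sup>2 = \<eta>\<^sup>2 * (norm (g z x - gbar x))\<^sup>2" for z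
    by (simp add: scaleR_diff_right[symmetric] power_mult_distrib)
  have "(\<integral>z. x + \<eta> *\<^sub>R g z x \<partial>\<xi> x) = x + \<eta> *\<^sub>R gbar x"
    using gint[of x] by (simp add: prob_space gbar mean_grad_def)
  moreover have "\<eta>\<^sup>2 * (\<integral>z. (norm (g z x - gbar x))\<^sup>2 \<partial>\<xi> x) \<le> \<eta>\<^sup>2 * min (\<sigma>2\<^sup>2) (\<sigma>4\<^sup>2)"
    using noise_variance(2)[of x] by (rule mult_left_mono) simp
  moreover have "integrable (\<xi> x) (\<lambda>z. \<eta>\<^sup>2 * (norm (g z x - gbar x))\<^sup>2)"
    using noise_variance(1)[of x] by simp
  ultimately show ?thesis
    unfolding eq using prob_space_distr[OF m]
    by (simp add: mean_var_def space_prob_algebra integrable_distr_eq[OF m] integral_distr[OF m] dev)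
qed

lemma local_run_Suc: "local_run \<xi> g \<eta> (Suc h) \<theta> = local_run \<xi> g \<eta> h \<theta> \<bind> local_step"
  by (simp add: local_step_def[abs_def])

lemma local_run_measurable: "local_run \<xi> g \<eta> h \<in> borel \<rightarrow>\<^sub>M prob_algebra borel"
proof (induction h)
  case 0
  have "local_run \<xi> g \<eta> 0 = return borel" by (rule ext) simp
  then show ?case by simp
next
  case (Suc h)
  have "local_run \<xi> g \<eta> (Suc h) = (\<lambda>\<theta>. local_run \<xi> g \<eta> h \<theta> \<bind> local_step)"
    by (rule ext) (rule local_run_Suc)
  then show ?case using measurable_bind_prob_space[OF Suc local_step_measurable] by simp
qed

text \<open>The expectation of the h-th local iterate, as \<open>local_run_mean_var\<close> shows;
  it is written as an integral over the previous law because \<open>mean_var_bind\<close> delivers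
  the next mean in this shape.\<close>

primrec local_mean :: "'a \<Rightarrow> nat \<Rightarrow> 'a" where
  "local_mean \<theta> 0 = \<theta>"
| "local_mean \<theta> (Suc h) = (\<integral>x. x + \<eta> *\<^sub>R gbar x \<partial>local_run \<xi> g \<eta> h \<theta>)"

lemma local_run_mean_var:
  assumes "h \<le> H"
  shows "mean_var (local_run \<xi> g \<eta> h \<theta>) (local_mean \<theta> h) (2 * real h * \<eta>\<^sup>2 * min (\<sigma>2\<^sup>2) (\<sigma>4\<^sup>2))"
  using assms
proof (induction h)
  case 0
  then show ?case using mean_var_return by simp
next
  case (Suc h)
  define s where "s = min (\<sigma>2\<^sup>2) (\<sigma>4\<^sup>2)"
  have "0 \<le> s" by (simp add: s_def)
  have lip: "norm (x + \<eta> *\<^sub>R gbar x - (y + \<eta> *\<^sub>R gbar y)) \<le> (1 + \<eta> * L2) * norm (x - y)" for x y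
  proof -
    have "norm (x + \<eta> *\<^sub>R gbar x - (y + \<eta> *\<^sub>R gbar y)) = norm ((x - y) + \<eta> *\<^sub>R (gbar x - gbar y))"
      by (simp add: algebra_simps)
    also have "\<dots> \<le> norm (x - y) + \<eta> * (L2 * norm (x - y))"
      using glip[of x y] \<eta> by (intro norm_triangle_le add_left_mono) (auto intro: mult_left_mono)
    finally show ?thesis by (simp add: algebra_simps)
  qed
  have "mean_var (local_run \<xi> g \<eta> (Suc h) \<theta>) (local_mean \<theta> (Suc h))
      ((1 + \<eta> * L2)\<^sup>2 * (2 * real h * \<eta>\<^sup>2 * s) + \<eta>\<^sup>2 * s)"
    unfolding local_run_Suc using Suc s_def
    by (auto intro!: mean_var_bind local_step_measurable local_step_mean_var lip)
  \<comment> \<open>With x = \<eta> L2, the step enlarges the old bound by 2 h x (2 + x) units of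
    \<open>\<eta>\<^sup>2 * s\<close>. As x and h x are at most 1/6, this is at most 13/18; together
    with the fresh unit of noise it stays within the 2 units that one more step allows.\<close>
  moreover have "(1 + \<eta> * L2)\<^sup>2 * (2 * real h * \<eta>\<^sup>2 * s) + \<eta>\<^sup>2 * s \<le> 2 * real (Suc h) * \<eta>\<^sup>2 * s"
  proof -
    have "\<eta> * L2 * real (Suc h) \<le> \<eta> * L2 * real H"
      using Suc.prems \<eta> nonneg by (intro mult_left_mono) auto
    also have "\<dots> = \<eta> * real H * L2" by simp
    finally have a: "\<eta> * L2 * real (Suc h) \<le> 1 / 6" using \<eta>(2) by linarith
    have p: "0 \<le> \<eta> * L2" using \<eta> nonneg by simp
    have a1: "\<eta> * L2 \<le> 1 / 6" and a2: "\<eta> * L2 * real h \<le> 1 / 6"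
      using a p mult_nonneg_nonneg[OF p of_nat_0_le_iff[of h]] unfolding of_nat_Suc distrib_left mult_1_right
      by linarith+
    have "(\<eta> * L2 * real h) * (2 * (2 + \<eta> * L2)) \<le> 1 / 6 * (2 * (2 + 1 / 6))"
      using a1 a2 p by (intro mult_mono) auto
    then have "(\<eta> * L2 * real h) * (2 * (2 + \<eta> * L2)) \<le> 1" by simp
    then have "(\<eta> * L2 * real h) * (2 * (2 + \<eta> * L2)) * (\<eta>\<^sup>2 * s) \<le> 1 * (\<eta>\<^sup>2 * s)"
      using \<open>0 \<le> s\<close> by (intro mult_right_mono) auto
    then show ?thesis by (simp add: power2_eq_square algebra_simps)
  qed
  ultimately show ?case by (auto simp: mean_var_def s_def)
qed

text \<open>The Hessian term is linear in \<open>x - m\<close> and integrates to 0 because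
  \<open>m\<close> is the mean, so a spread \<open>V\<close> shifts the mean gradient only through
  the Taylor remainder.\<close>

lemma mean_gradient_bias:
  assumes L: "mean_var L m V"
  shows "norm ((\<integral>x. gbar x \<partial>L) - grad f m) \<le> \<beta> + L3 * V"
proof -
  note D = mean_varD[OF L]
  interpret prob_space L by (rule D)
  have ig: "integrable L gbar" and iG: "integrable L (grad f)"
    using mean_var_lipschitz(2)[OF L glip] mean_var_lipschitz(2)[OF L grad_lipschitz[OF f3 hess]] by auto
  have iid: "integrable L (\<lambda>x. x)" by (rule mean_var_integrable[OF L])
  have ih: "integrable L (\<lambda>x. hess f m (x - m))"
    using iid by (intro integrable_bounded_linear[OF blinfun.bounded_linear_right]) auto
  have h0: "(\<integral>x. hess f m (x - m) \<partial>L) = 0"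
    using iid D(3) by (subst integral_bounded_linear[OF blinfun.bounded_linear_right]) (auto simp: prob_space)
  define E where "E x = (gbar x - grad f x) + (grad f x - grad f m - hess f m (x - m))" for x
  have iE: "integrable L E"
    unfolding E_def using ig iG ih by auto
  have "(\<integral>x. gbar x \<partial>L) - grad f m = (\<integral>x. gbar x - grad f m - hess f m (x - m) \<partial>L)"
    using ig ih h0 by (simp add: prob_space)
  also have "\<dots> = (\<integral>x. E x \<partial>L)" by (simp add: E_def algebra_simps)
  also have "norm \<dots> \<le> (\<integral>x. norm (E x) \<partial>L)" by (rule integral_norm_bound)
  also have "\<dots> \<le> (\<integral>x. \<beta> + L3 * (norm (x - m))\<^sup>2 \<partial>L)"
  proof (rule integral_mono)
    show "norm (E x) \<le> \<beta> + L3 * (norm (x - m))\<^sup>2" for x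
      unfolding E_def using bias[of x] grad_taylor[OF f3 third, of x m]
      by (intro norm_triangle_le add_mono) (auto simp: norm_minus_commute)
  qed (use iE D in auto)
  also have "\<dots> \<le> \<beta> + L3 * V"
    using D nonneg by (simp add: prob_space mult_left_mono)
  finally show ?thesis .
qed

text \<open>\<open>\<beta> + L3 * V\<close> with \<open>V\<close> enlarged to its value for
  \<open>H\<close> steps and \<open>\<sigma>4\<close>: one bound for all local steps.\<close>

definition drift_error :: real where
  "drift_error = \<beta> + 2 * L3 * real H * \<eta>\<^sup>2 * \<sigma>4\<^sup>2"

lemma local_mean_drift:
  "norm (local_mean \<theta> H - \<theta> - (\<eta> * real H) *\<^sub>R grad f \<theta>)
    \<le> \<eta> * real H * (drift_error + (norm (grad f \<theta>) + drift_error) / 5)"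
proof -
  have "norm (local_mean \<theta> (Suc h) - local_mean \<theta> h - \<eta> *\<^sub>R grad f (local_mean \<theta> h)) \<le> \<eta> * drift_error"
    if "h < H" for h
  proof -
    let ?L = "local_run \<xi> g \<eta> h \<theta>" and ?V = "2 * real h * \<eta>\<^sup>2 * min (\<sigma>2\<^sup>2) (\<sigma>4\<^sup>2)"
    have L: "mean_var ?L (local_mean \<theta> h) ?V" using that by (intro local_run_mean_var) auto
    interpret prob_space ?L using mean_varD[OF L] by simp
    have "local_mean \<theta> (Suc h) = local_mean \<theta> h + \<eta> *\<^sub>R (\<integral>x. gbar x \<partial>?L)"
      using mean_var_integrable[OF L] mean_var_lipschitz(2)[OF L glip] mean_varD(3)[OF L]
      by simp
    then have "norm (local_mean \<theta> (Suc h) - local_mean \<theta> h - \<eta> *\<^sub>R grad f (local_mean \<theta> h))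
        = \<eta> * norm ((\<integral>x. gbar x \<partial>?L) - grad f (local_mean \<theta> h))"
      using \<eta> by (simp add: scaleR_diff_right[symmetric])
    also have "\<dots> \<le> \<eta> * (\<beta> + L3 * ?V)"
      using mean_gradient_bias[OF L] \<eta> by (intro mult_left_mono) auto
    also have "\<dots> \<le> \<eta> * drift_error"
    proof -
      have "?V \<le> 2 * real H * \<eta>\<^sup>2 * \<sigma>4\<^sup>2"
        using that by (intro mult_mono) auto
      then have "L3 * ?V \<le> L3 * (2 * real H * \<eta>\<^sup>2 * \<sigma>4\<^sup>2)"
        using nonneg by (intro mult_left_mono) auto
      then show ?thesis unfolding drift_error_def
        using \<eta> by (intro mult_left_mono add_left_mono) (auto simp: mult_ac)
    qed
    finally show ?thesis .
  qed
  moreover have "0 \<le> drift_error" using nonneg by (simp add: drift_error_def)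
  ultimately show ?thesis
    using perturbed_gradient_steps[of "grad f" L2 drift_error \<eta> H "local_mean \<theta>"]
      grad_lipschitz[OF f3 hess] nonneg \<eta> by simp
qed

end

text \<open>The error costs at most |v| (\<epsilon> + |v|/5) by Cauchy-Schwarz, the curvature at
  most (\<epsilon> + 6/5 |v|)^2 / 12 because s L / 2 \<le> 1/12. Both leave more than half of |v|^2,
  so the mixed terms can be absorbed into a multiple of \<epsilon>^2.\<close>

lemma inexact_ascent:
  fixes v e :: "'a::real_inner"
  assumes e: "norm e \<le> \<epsilon> + norm v / 5" and "0 \<le> \<epsilon>" "0 \<le> s" "0 \<le> L" "s * L \<le> 1 / 6"
  shows "s * ((norm v)\<^sup>2 / 2 - 6 * \<epsilon>\<^sup>2)
    \<le> inner v (s *\<^sub>R (v + e)) - L / 2 * (norm (s *\<^sub>R (v + e)))\<^sup>2"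
proof -
  have "\<bar>inner v e\<bar> \<le> norm v * (\<epsilon> + norm v / 5)"
    using Cauchy_Schwarz_ineq2[of v e] e by (meson mult_left_mono norm_ge_zero order_trans)
  then have 1: "(norm v)\<^sup>2 - norm v * (\<epsilon> + norm v / 5) \<le> inner v (v + e)"
    by (simp add: inner_add_right power2_norm_eq_inner)
  have "norm (v + e) \<le> \<epsilon> + 6 / 5 * norm v"
    using norm_triangle_ineq[of v e] e by simp
  then have 2: "(norm (v + e))\<^sup>2 \<le> (\<epsilon> + 6 / 5 * norm v)\<^sup>2"
    by (simp add: power_mono)
  have "L / 2 * (norm (s *\<^sub>R (v + e)))\<^sup>2 = (s * L) * (s / 2 * (norm (v + e))\<^sup>2)"
    by (simp add: power_mult_distrib power2_eq_square)
  also have "\<dots> \<le> 1 / 6 * (s / 2 * (norm (v + e))\<^sup>2)"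
    using assms by (intro mult_right_mono) auto
  also have "\<dots> \<le> s * ((\<epsilon> + 6 / 5 * norm v)\<^sup>2 / 12)"
    using 2 \<open>0 \<le> s\<close> mult_left_mono by fastforce
  finally have 3: "L / 2 * (norm (s *\<^sub>R (v + e)))\<^sup>2 \<le> s * ((\<epsilon> + 6 / 5 * norm v)\<^sup>2 / 12)" .
  \<comment> \<open>Completing the square: the coefficient of |v|^2 is 1 - 1/5 - 3/25 - 1/2 = 9/50.
    Of the 6 \<epsilon>^2 the curvature takes 1/12 and the square takes 2, which leaves
    47/12.\<close>
  have "(norm v)\<^sup>2 - norm v * (\<epsilon> + norm v / 5) - (\<epsilon> + 6 / 5 * norm v)\<^sup>2 / 12
      - ((norm v)\<^sup>2 / 2 - 6 * \<epsilon>\<^sup>2)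
      = 9 / 50 * (norm v - 10 / 3 * \<epsilon>)\<^sup>2 + 47 / 12 * \<epsilon>\<^sup>2"
    by (simp add: power2_eq_square field_simps)
  also have "0 \<le> \<dots>" by simp
  finally have "s * ((norm v)\<^sup>2 / 2 - 6 * \<epsilon>\<^sup>2) \<le>
      s * ((norm v)\<^sup>2 - norm v * (\<epsilon> + norm v / 5) - (\<epsilon> + 6 / 5 * norm v)\<^sup>2 / 12)"
    using \<open>0 \<le> s\<close> by (intro mult_left_mono) auto
  also have "\<dots> \<le> s * (inner v (v + e) - (\<epsilon> + 6 / 5 * norm v)\<^sup>2 / 12)"
    using 1 \<open>0 \<le> s\<close> by (intro mult_left_mono) auto
  finally show ?thesis using 3 by (simp add: right_diff_distrib)
qed

section \<open>Scalar recursions and the 1/R rate\<close>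

text \<open>Since s is a fixed point of y - a y^2 + a s^2, the excess w = y - s obeys w' \<le> w - a w^2.\<close>

lemma quadratic_recursion:
  fixes y :: "nat \<Rightarrow> real"
  assumes a: "0 \<le> a" and s: "0 \<le> s" and Y: "0 \<le> Y" "Y \<le> B" and aB: "2 * a * B \<le> 1"
    and y: "\<And>r. 0 \<le> y r" "\<And>r. y r \<le> B" and y0: "y 0 \<le> Y"
    and step: "\<And>r. y (Suc r) \<le> y r - a * (y r)\<^sup>2 + a * s\<^sup>2"
  shows "y r \<le> s + Y / (1 + a * real r * Y)"
proof (induction r)
  case 0
  then show ?case using y0 s by simp
next
  case (Suc r)
  define z where "z = Y / (1 + a * real r * Y)"
  define z' where "z' = Y / (1 + a * real (Suc r) * Y)"
  \<comment> \<open>The update map is increasing on values up to \<open>B\<close> because 2 a B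
    \<le> 1, so upper bounds may be inserted into it.\<close>
  have mono: "t - a * t\<^sup>2 \<le> u - a * u\<^sup>2" if "t \<le> u" "u \<le> B" for t u
  proof -
    have "a * (t + u) \<le> a * (2 * B)" using that a by (intro mult_left_mono) auto
    then have "0 \<le> (u - t) * (1 - a * (t + u))" using that aB by (intro mult_nonneg_nonneg) auto
    then show ?thesis by (simp add: power2_eq_square algebra_simps)
  qed
  have d: "1 \<le> 1 + a * real r * Y" using a Y by simp
  have z: "0 \<le> z" "z \<le> Y" using d Y mult_left_mono[OF d Y(1)] by (auto simp: z_def divide_simps)
  have "0 \<le> a * z" using a z by simp
  have z': "z' = z / (1 + a * z)"
  proof -
    have "1 + a * z = (1 + a * real (Suc r) * Y) / (1 + a * real r * Y)"
      using d by (simp add: z_def field_simps)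
    then show ?thesis using d by (simp add: z_def z'_def)
  qed
  \<comment> \<open>The left side equals z - a^2 z^3.\<close>
  have "(z - a * z\<^sup>2) * (1 + a * z) \<le> z"
    using z a by (simp add: power2_eq_square algebra_simps)
  then have zz': "z - a * z\<^sup>2 \<le> z'"
    unfolding z' using \<open>0 \<le> a * z\<close> by (simp add: pos_le_divide_eq)
  have z'0: "0 \<le> z'" unfolding z' using z \<open>0 \<le> a * z\<close> by simp
  have "y (Suc r) \<le> s + z'"
  proof (cases "y r \<le> s")
    case True
    \<comment> \<open>For s \<le> B monotonicity bounds the next value by the fixed point
      \<open>s\<close>; for s > B the bound \<open>B\<close> on the sequence already does.\<close>
    then show ?thesis
      using mono[of "y r" s] step[of r] y(2)[of "Suc r"] z'0 by (cases "s \<le> B") auto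
  next
    case False
    define w where "w = y r - s"
    have w: "0 < w" "w \<le> z" using False Suc by (auto simp: w_def z_def)
    \<comment> \<open>This drops the cross term 2 s w of (w + s)^2; the constant a s^2 then cancels
      from the recursion for the excess \<open>w\<close>.\<close>
    have "s * s \<le> s * y r" using s False by (intro mult_left_mono) auto
    then have "a * (w\<^sup>2 + s\<^sup>2) \<le> a * (y r)\<^sup>2"
      using a by (intro mult_left_mono) (auto simp: w_def power2_eq_square algebra_simps)
    then have "y (Suc r) \<le> s + (w - a * w\<^sup>2)"
      using step[of r] by (simp add: w_def distrib_left)
    also have "\<dots> \<le> s + (z - a * z\<^sup>2)"
      using mono[OF w(2)] z Y by simp
    finally show ?thesis using zz' by simp
  qed
  then show ?case by (simp add: z'_def)
qed

text \<open>t / (1 + c t) is the value at time c of the solution of x' = -x^2 started at t, the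
  continuous counterpart of the recursion.\<close>

lemma div_one_plus_mono:
  fixes c :: real
  assumes "0 \<le> c" "0 \<le> t" "t \<le> u"
  shows "t / (1 + c * t) \<le> u / (1 + c * u)"
proof -
  have "0 < 1 + c * t" "0 < 1 + c * u" using assms by (auto intro: add_pos_nonneg)
  then show ?thesis using assms by (simp add: divide_simps algebra_simps)
qed

lemma div_one_plus_subadditive:
  fixes c :: real
  assumes "0 \<le> c" "0 \<le> t" "0 \<le> n"
  shows "(t + n) / (1 + c * (t + n)) \<le> t / (1 + c * t) + n"
proof -
  have p: "0 < 1 + c * t" "1 \<le> 1 + c * (t + n)" "0 < 1 + c * (t + n)" using assms by (auto intro: add_pos_nonneg)
  have "(t + n) / (1 + c * (t + n)) = t / (1 + c * (t + n)) + n / (1 + c * (t + n))"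
    by (rule add_divide_distrib)
  also have "\<dots> \<le> t / (1 + c * t) + n"
  proof (intro add_mono)
    show "t / (1 + c * (t + n)) \<le> t / (1 + c * t)"
      using assms by (intro divide_left_mono mult_pos_pos p) (auto intro: mult_left_mono)
    show "n / (1 + c * (t + n)) \<le> n"
      using p assms by (simp add: pos_divide_le_eq mult_le_cancel_left1)
  qed
  finally show ?thesis .
qed

text \<open>Trades the value \<open>Y\<close> after the first round for the initial gap
  \<open>D\<close>, the error \<open>n\<close> of that round being additive. Since 2 a Y0 \<le> 1,
  one has 1 + 2 a (r + 1) Y0 \<le> 2 (1 + a r Y0): the factor 2 pays both for the doubled rate and
  for the first round, which the recursion does not see.\<close>

lemma recursion_rate:
  fixes a B D n :: real
  assumes a: "0 \<le> a" and aB: "2 * a * B \<le> 1" and "0 \<le> B" "0 \<le> D" "0 \<le> n"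
  defines "Y \<equiv> min B (D + n)"
  shows "Y / (1 + a * real r * Y) \<le> 2 * D / (1 + real (Suc r) * D * (2 * a)) + n"
proof -
  define Y0 where "Y0 = min B D"
  have Y0: "0 \<le> Y0" "Y0 \<le> B" "Y0 \<le> D" and Y: "0 \<le> Y" "Y \<le> Y0 + n"
    using assms by (auto simp: Y0_def)
  have ar: "0 \<le> a * real r" using a by simp
  have "Y / (1 + a * real r * Y) \<le> (Y0 + n) / (1 + a * real r * (Y0 + n))"
    by (rule div_one_plus_mono[OF ar Y])
  also have "\<dots> \<le> Y0 / (1 + a * real r * Y0) + n"
    using ar Y0(1) \<open>0 \<le> n\<close> by (rule div_one_plus_subadditive)
  also have "Y0 / (1 + a * real r * Y0) \<le> 2 * (Y0 / (1 + 2 * a * real (Suc r) * Y0))"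
  proof -
    have "2 * a * Y0 \<le> 1"
      using mult_left_mono[OF Y0(2), of "2 * a"] a aB by simp
    then have "1 + 2 * a * real (Suc r) * Y0 \<le> 2 * (1 + a * real r * Y0)"
      by (simp add: algebra_simps)
    moreover have "0 < 1 + 2 * a * real (Suc r) * Y0" "0 < 1 + a * real r * Y0"
      using a Y0(1) by (auto intro!: add_pos_nonneg)
    ultimately show ?thesis
      using mult_left_mono[of "1 + 2 * a * real (Suc r) * Y0" "2 * (1 + a * real r * Y0)" Y0] Y0(1)
      by (simp add: divide_simps) (simp add: algebra_simps)
  qed
  also have "Y0 / (1 + 2 * a * real (Suc r) * Y0) \<le> D / (1 + 2 * a * real (Suc r) * D)"
    using a Y0 by (intro div_one_plus_mono) auto
  finally show ?thesis by (simp add: mult_ac)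
qed

subsection \<open>The quadratic Lojasiewicz condition\<close>

lemma le_fstar: "bdd_above (range f) \<Longrightarrow> f x \<le> fstar f"
  unfolding fstar_def by (rule cSUP_upper) auto

text \<open>The supremum need not be attained and may be infinite. If the inequality failed, the gap
  would be nonzero and every admissible x at most G / (2 d) < \<mu>, hence the supremum too.\<close>

lemma QL_inequality:
  assumes "ereal \<mu> \<le> QL_mu f \<theta>"
  shows "2 * \<mu> * (fstar f - f \<theta>)\<^sup>2 \<le> (norm (grad f \<theta>))\<^sup>2"
proof (rule ccontr)
  define d where "d = (fstar f - f \<theta>)\<^sup>2"
  define G where "G = (norm (grad f \<theta>))\<^sup>2"
  assume "\<not> ?thesis"
  then have less: "G < 2 * \<mu> * d" by (simp add: d_def G_def)
  have "0 \<le> G" "0 \<le> d" by (auto simp: G_def d_def)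
  with less have d: "0 < d" by (cases "d = 0") auto
  have "QL_mu f \<theta> \<le> ereal (G / (2 * d))"
    unfolding QL_mu_def using d
    by (intro Sup_least) (auto simp: pos_le_divide_eq d_def[symmetric] G_def[symmetric] mult_ac)
  also have "\<dots> < ereal \<mu>"
    using less d by (simp add: pos_divide_less_eq mult_ac)
  finally show False using assms by simp
qed

text \<open>A step of length \<open>1 / L\<close> along the gradient gains at least |G|^2 / (2 L),
  and no value exceeds the supremum.\<close>

lemma gradient_norm_le_gap:
  fixes f :: "'a::euclidean_space \<Rightarrow> real"
  assumes G: "\<And>x. GDERIV f x :> G x" and "0 < L"
    and L: "\<And>x y. norm (G x - G y) \<le> L * norm (x - y)"
    and bdd: "bdd_above (range f)"
  shows "(norm (G x))\<^sup>2 \<le> 2 * L * (fstar f - f x)"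
proof -
  have "f x + inner (G x) ((1 / L) *\<^sub>R G x) - L / 2 * (norm ((1 / L) *\<^sub>R G x))\<^sup>2 \<le> fstar f"
    using descent_lower_bound[OF G L, of x "x + (1 / L) *\<^sub>R G x"] le_fstar[OF bdd, of "x + (1 / L) *\<^sub>R G x"]
    by simp
  moreover have "inner (G x) ((1 / L) *\<^sub>R G x) - L / 2 * (norm ((1 / L) *\<^sub>R G x))\<^sup>2 = (norm (G x))\<^sup>2 / (2 * L)"
    using \<open>0 < L\<close> by (simp add: dot_square_norm power_mult_distrib) (simp add: field_simps power2_eq_square)
  ultimately have "(norm (G x))\<^sup>2 / (2 * L) \<le> fstar f - f x" by simp
  then show ?thesis
    using \<open>0 < L\<close> by (simp add: pos_divide_le_eq mult.commute)
qed

lemma avg_mono: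
  fixes v w :: "nat \<Rightarrow> real"
  shows "(\<And>c. c \<in> {1..M} \<Longrightarrow> v c \<le> w c) \<Longrightarrow> avg M v \<le> avg M w"
  unfolding avg_def by (intro scaleR_left_mono sum_mono) auto

lemma avg_const [simp]: "1 \<le> M \<Longrightarrow> avg M (\<lambda>c. v) = v"
  by (simp add: avg_def scaleR_sum_left[symmetric] sum_constant_scaleR)

lemma avg_diff: "avg M (\<lambda>c. v c - w c) = avg M v - avg M w"
  by (simp add: avg_def sum_subtractf scaleR_diff_right)

lemma avg_scaleR: "avg M (\<lambda>c. a *\<^sub>R v c) = a *\<^sub>R avg M v"
  by (simp add: avg_def scaleR_sum_right)

lemma norm_avg_le:
  fixes v :: "nat \<Rightarrow> 'a::real_normed_vector"
  shows "norm (avg M v) \<le> avg M (\<lambda>c. norm (v c))"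
  unfolding avg_def by (simp add: norm_sum divide_right_mono)

lemma norm_avg_bound:
  fixes v :: "nat \<Rightarrow> 'a::real_normed_vector"
  assumes "1 \<le> M" "\<And>c. c \<in> {1..M} \<Longrightarrow> norm (v c) \<le> b"
  shows "norm (avg M v) \<le> b"
  using norm_avg_le[of M v] avg_mono[of M "\<lambda>c. norm (v c)" "\<lambda>c. b"] assms by simp

text \<open>\<open>E\<close> stands for \<open>\<eta>\<^sup>2 * L3 * H * \<sigma>4\<^sup>2\<close>
  and \<open>w\<close> for \<open>\<eta> * L2 * \<sigma>2\<^sup>2 / M\<close>, so \<open>N\<close>
  is the error per round, divided by the period. The first bound treats the level at which the
  recursion stalls, the second the error of the first round.\<close>

lemma error_terms_bound:
  fixes \<zeta> \<beta> E w \<mu> L :: real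
  assumes "0 \<le> \<zeta>" "0 \<le> \<beta>" "0 \<le> E" "0 \<le> w" "0 < \<mu>" "0 < L"
  defines "N \<equiv> 6 * (6 / 5 * (\<beta> + 2 * E) + \<zeta> / 5)\<^sup>2 + w + \<zeta>\<^sup>2 / 2"
  shows "sqrt (2 * N / \<mu>) \<le> 20 * ((\<zeta> + \<beta>) / sqrt \<mu> + E / sqrt \<mu> + sqrt (w / \<mu>))"
    and "N / (6 * L) \<le> 20 * ((\<zeta>\<^sup>2 + \<beta>\<^sup>2) / L + E\<^sup>2 / L + w / L)"
proof -
  define p where "p = \<zeta> + \<beta>"
  have p: "0 \<le> p" "\<zeta> \<le> p" using assms by (auto simp: p_def)
  have "0 \<le> 6 / 5 * (\<beta> + 2 * E) + \<zeta> / 5" "6 / 5 * (\<beta> + 2 * E) + \<zeta> / 5 \<le> 6 / 5 * p + 12 / 5 * E"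
    using assms(1-3) by (auto simp: p_def field_simps)
  then have "(6 / 5 * (\<beta> + 2 * E) + \<zeta> / 5)\<^sup>2 \<le> (6 / 5 * p + 12 / 5 * E)\<^sup>2"
    by (intro power_mono)
  also have "\<dots> \<le> 3 * p\<^sup>2 + 12 * E\<^sup>2"
  proof -
    have "3 * p\<^sup>2 + 12 * E\<^sup>2 - (6 / 5 * p + 12 / 5 * E)\<^sup>2
        = (6 / 5 * p - 12 / 5 * E)\<^sup>2 + 3 / 25 * p\<^sup>2 + 12 / 25 * E\<^sup>2"
      by (simp add: power2_eq_square field_simps)
    also have "0 \<le> \<dots>" by simp
    finally show ?thesis by simp
  qed
  finally have "(6 / 5 * (\<beta> + 2 * E) + \<zeta> / 5)\<^sup>2 \<le> 3 * p\<^sup>2 + 12 * E\<^sup>2" .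
  moreover have "\<zeta>\<^sup>2 \<le> p\<^sup>2" using p assms(1-6) by (intro power_mono) auto
  \<comment> \<open>18 = 6 * 3 plus 1/2 is rounded up to 19, and 72 = 6 * 12. Below, 20 covers both
    claims: 20^2 exceeds 2 * 72, and 120 / 6 = 20.\<close>
  ultimately have N: "N \<le> 19 * p\<^sup>2 + 72 * E\<^sup>2 + w"
    using zero_le_power2[of p] unfolding N_def by linarith
  have N': "2 * N \<le> (20 * (p + E + sqrt w))\<^sup>2"
  proof -
    have "p\<^sup>2 + E\<^sup>2 + w \<le> (p + E + sqrt w)\<^sup>2"
      using assms(1-6) p by (simp add: power2_eq_square algebra_simps)
    moreover have "(20 * (p + E + sqrt w))\<^sup>2 = 400 * (p + E + sqrt w)\<^sup>2"
      by (subst power_mult_distrib) simp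
    ultimately show ?thesis using N assms(4) zero_le_power2[of p] zero_le_power2[of E] by linarith
  qed
  have "sqrt (2 * N / \<mu>) = sqrt (2 * N) / sqrt \<mu>" by (rule real_sqrt_divide)
  also have "\<dots> \<le> 20 * (p + E + sqrt w) / sqrt \<mu>"
    using N' assms(1-6) p by (intro divide_right_mono real_le_lsqrt) auto
  also have "\<dots> = 20 * ((\<zeta> + \<beta>) / sqrt \<mu> + E / sqrt \<mu> + sqrt (w / \<mu>))"
    by (simp add: p_def real_sqrt_divide add_divide_distrib)
  finally show "sqrt (2 * N / \<mu>) \<le> 20 * ((\<zeta> + \<beta>) / sqrt \<mu> + E / sqrt \<mu> + sqrt (w / \<mu>))" .
  have "p\<^sup>2 \<le> 2 * (\<zeta>\<^sup>2 + \<beta>\<^sup>2)"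
    using zero_le_power2[of "\<zeta> - \<beta>"] by (simp add: p_def power2_eq_square algebra_simps)
  then have "N \<le> 120 * (\<zeta>\<^sup>2 + \<beta>\<^sup>2 + E\<^sup>2 + w)"
    using N assms(1-6) zero_le_power2[of \<zeta>] zero_le_power2[of \<beta>] zero_le_power2[of E]
    unfolding distrib_left by linarith
  then have "N / (6 * L) \<le> 120 * (\<zeta>\<^sup>2 + \<beta>\<^sup>2 + E\<^sup>2 + w) / (6 * L)"
    using assms(5,6) by (intro divide_right_mono) auto
  then show "N / (6 * L) \<le> 20 * ((\<zeta>\<^sup>2 + \<beta>\<^sup>2) / L + E\<^sup>2 / L + w / L)"
    by (simp add: add_divide_distrib)
qed

subsection \<open>Communication rounds\<close>

locale federation =
  fixes M H :: nat and f :: "nat \<Rightarrow> 'a::euclidean_space \<Rightarrow> real" and F :: "'a \<Rightarrow> real" and Fstar :: real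
    and Zs :: "'z measure" and \<xi> :: "nat \<Rightarrow> 'a \<Rightarrow> 'z measure" and g :: "nat \<Rightarrow> 'z \<Rightarrow> 'a \<Rightarrow> 'a"
    and gbar :: "nat \<Rightarrow> 'a \<Rightarrow> 'a" and T :: "'a \<Rightarrow> 'a"
    and L1 L2 L3 \<zeta> \<beta> \<sigma>2 \<sigma>4 \<mu> \<eta> :: real
  assumes M: "1 \<le> M" and H: "1 \<le> H"
    and agent: "\<And>c. c \<in> {1..M} \<Longrightarrow>
      local_agent (f c) Zs (\<xi> c) (g c) (gbar c) L2 L3 \<beta> \<sigma>2 \<sigma>4 \<eta> H"
    and bdd: "\<And>c. c \<in> {1..M} \<Longrightarrow> bdd_above (range (f c))"
    and F: "F = (\<lambda>\<theta>. avg M (\<lambda>c. f c \<theta>))"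
    and Fstar: "Fstar = avg M (\<lambda>c. fstar (f c))"
    and T: "T \<in> borel_measurable borel"
    and \<zeta>: "0 \<le> \<zeta>"
    and grad_bounded: "\<And>c \<theta>. c \<in> {1..M} \<Longrightarrow> norm (grad (f c) \<theta>) \<le> L1"
    and heterogeneity: "\<And>c \<theta>. c \<in> {1..M} \<Longrightarrow> norm (grad F \<theta> - grad (f c) \<theta>) \<le> \<zeta>"
    and \<mu>: "0 < \<mu>"
    and QL: "\<And>c \<theta>. c \<in> {1..M} \<Longrightarrow> ereal \<mu> \<le> QL_mu (f c) (T \<theta>)"
    and T_ascent: "\<And>\<theta>. F \<theta> \<le> F (T \<theta>)"
begin

definition gap :: "'a \<Rightarrow> real" where
  "gap \<theta> = Fstar - F \<theta>"

definition period :: real where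
  "period = \<eta> * real H"

lemma one_in: "1 \<in> {1..M}"
  using M by simp

text \<open>The constraints on the parameters belong to the single agents; as \<open>M\<close> is
  positive, agent 1 supplies them.\<close>

lemma params: "0 < L2" "0 \<le> L3" "0 \<le> \<beta>" "0 < \<eta>" "period * L2 \<le> 1 / 6" "0 < period"
proof -
  interpret local_agent "f 1" Zs "\<xi> 1" "g 1" "gbar 1" L2 L3 \<beta> \<sigma>2 \<sigma>4 \<eta> H
    by (rule agent[OF one_in])
  show "0 < L2" "0 \<le> L3" "0 \<le> \<beta>" "0 < \<eta>" "period * L2 \<le> 1 / 6" "0 < period"
    using nonneg \<eta> H by (auto simp: period_def)
qed

lemma agent_GDERIV: "c \<in> {1..M} \<Longrightarrow> GDERIV (f c) \<theta> :> grad (f c) \<theta>"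
  using local_agent.f3[OF agent] by (intro GDERIV_grad) (auto simp: three_times_differentiable_def)

lemma agent_grad_lipschitz:
  "c \<in> {1..M} \<Longrightarrow> norm (grad (f c) x - grad (f c) y) \<le> L2 * norm (x - y)"
  using local_agent.f3[OF agent] local_agent.hess[OF agent] by (rule grad_lipschitz)

lemma F_GDERIV: "GDERIV F \<theta> :> avg M (\<lambda>c. grad (f c) \<theta>)"
  unfolding F using agent_GDERIV by (rule GDERIV_avg)

lemma grad_F: "grad F \<theta> = avg M (\<lambda>c. grad (f c) \<theta>)"
  using F_GDERIV by (rule grad_eqI)

lemma grad_F_lipschitz: "norm (grad F x - grad F y) \<le> L2 * norm (x - y)"
  unfolding grad_F avg_diff[symmetric] using M agent_grad_lipschitz by (rule norm_avg_bound)

text \<open>Provides the integrability of \<open>F\<close> under the law of the averaged iterate, by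
  \<open>mean_var_lipschitz\<close>.\<close>

lemma F_lipschitz: "norm (F x - F y) \<le> L1 * norm (x - y)"
proof -
  have "norm (grad F z) \<le> L1" for z
    unfolding grad_F using M grad_bounded by (rule norm_avg_bound)
  then have "onorm (\<lambda>h. inner h (grad F z)) \<le> L1" for z
    by (intro onorm_le) (metis Cauchy_Schwarz_ineq2 mult.commute mult_right_mono norm_ge_zero
      order_trans real_norm_def)
  then show ?thesis
    using F_GDERIV unfolding gderiv_def grad_F[symmetric]
    by (intro differentiable_bound[where S = UNIV and f' = "\<lambda>z h. inner h (grad F z)"]) auto
qed

lemma F_continuous: "continuous_on UNIV F"
  using F_GDERIV unfolding gderiv_def
  by (meson continuous_at_imp_continuous_on has_derivative_continuous)

lemma grad_F_continuous: "continuous_on UNIV (grad F)"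
proof -
  have "L2-lipschitz_on UNIV (grad F)"
    using params grad_F_lipschitz by (intro lipschitz_onI) (auto simp: dist_norm)
  then show ?thesis by (rule lipschitz_on_continuous_on)
qed

lemma gap_measurable [measurable]: "gap \<in> borel_measurable borel"
  unfolding gap_def[abs_def] using borel_measurable_continuous_onI[OF F_continuous] by simp

lemma grad_F_measurable [measurable]: "grad F \<in> borel_measurable borel"
  using grad_F_continuous by (rule borel_measurable_continuous_onI)

lemma gap_eq_avg: "gap \<theta> = avg M (\<lambda>c. fstar (f c) - f c \<theta>)"
  by (subst gap_def) (simp add: F Fstar avg_diff)

lemma gap_nonneg: "0 \<le> gap \<theta>"
  unfolding gap_eq_avg using avg_mono[of M "\<lambda>c. 0" "\<lambda>c. fstar (f c) - f c \<theta>"] M le_fstar[OF bdd]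
  by simp

text \<open>For each agent the squared gradient lies between 2 \<mu> d^2 and 2 L2 d, and a nonzero
  gap d cancels.\<close>

lemma gap_T_le: "gap (T \<theta>) \<le> L2 / \<mu>"
proof -
  have "fstar (f c) - f c (T \<theta>) \<le> L2 / \<mu>" if c: "c \<in> {1..M}" for c
  proof -
    define d where "d = fstar (f c) - f c (T \<theta>)"
    have "2 * \<mu> * d\<^sup>2 \<le> 2 * L2 * d"
      using QL_inequality[OF QL[OF c]] params(1)
        gradient_norm_le_gap[OF agent_GDERIV[OF c] params(1) agent_grad_lipschitz[OF c] bdd[OF c]]
      unfolding d_def by (meson order_trans)
    then have "d * (\<mu> * d) \<le> d * L2" by (simp add: power2_eq_square mult_ac)
    moreover have "0 \<le> d" using le_fstar[OF bdd[OF c]] by (simp add: d_def)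
    ultimately have "\<mu> * d \<le> L2" using params(1) by (cases "d = 0") auto
    then show ?thesis using \<mu> by (simp add: d_def pos_le_divide_eq mult.commute)
  qed
  then show ?thesis
    unfolding gap_eq_avg using avg_mono[of M _ "\<lambda>c. L2 / \<mu>"] M by simp
qed

text \<open>All agents' gaps obey the same bound \<open>q\<close>, hence so does their average. The
  factor 2 lost in (G + \<zeta>)^2 \<le> 2 (G^2 + \<zeta>^2) is the one present in (QL).\<close>

lemma gap_T_square_le: "\<mu> * (gap (T \<theta>))\<^sup>2 \<le> (norm (grad F (T \<theta>)))\<^sup>2 + \<zeta>\<^sup>2"
proof -
  define q where "q = sqrt (((norm (grad F (T \<theta>)))\<^sup>2 + \<zeta>\<^sup>2) / \<mu>)"
  have "fstar (f c) - f c (T \<theta>) \<le> q" if c: "c \<in> {1..M}" for c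
  proof -
    let ?G = "norm (grad F (T \<theta>))"
    define d where "d = fstar (f c) - f c (T \<theta>)"
    have "norm (grad (f c) (T \<theta>)) \<le> ?G + \<zeta>"
      using norm_triangle_ineq2[of "grad (f c) (T \<theta>)" "grad F (T \<theta>)"] heterogeneity[OF c, of "T \<theta>"]
      by (simp add: norm_minus_commute)
    then have "(norm (grad (f c) (T \<theta>)))\<^sup>2 \<le> (?G + \<zeta>)\<^sup>2" by (simp add: power_mono)
    also have "\<dots> \<le> 2 * (?G\<^sup>2 + \<zeta>\<^sup>2)"
      using zero_le_power2[of "?G - \<zeta>"] by (simp add: power2_eq_square algebra_simps)
    finally have "\<mu> * d\<^sup>2 \<le> ?G\<^sup>2 + \<zeta>\<^sup>2"
      using QL_inequality[OF QL[OF c], of \<theta>] by (simp add: d_def)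
    then have "d\<^sup>2 \<le> (?G\<^sup>2 + \<zeta>\<^sup>2) / \<mu>" using \<mu> by (simp add: pos_le_divide_eq mult.commute)
    then show ?thesis unfolding d_def[symmetric] q_def by (rule real_le_rsqrt)
  qed
  then have "gap (T \<theta>) \<le> q"
    unfolding gap_eq_avg using avg_mono[of M _ "\<lambda>c. q"] M by simp
  then have "(gap (T \<theta>))\<^sup>2 \<le> q\<^sup>2" using gap_nonneg by (intro power_mono) auto
  also have "\<dots> = ((norm (grad F (T \<theta>)))\<^sup>2 + \<zeta>\<^sup>2) / \<mu>" using \<mu> by (simp add: q_def)
  finally show ?thesis using \<mu> by (simp add: pos_le_divide_eq mult.commute)
qed

definition drift :: real where
  "drift = \<beta> + 2 * L3 * real H * \<eta>\<^sup>2 * \<sigma>4\<^sup>2"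

text \<open>The first term is the 6 \<epsilon>^2 of \<open>inexact_ascent\<close>; the second is
  \<open>L2 / 2\<close> times the variance bound of the averaged iterate, divided by
  \<open>period\<close>.\<close>

definition round_error :: real where
  "round_error = 6 * (6 / 5 * drift + \<zeta> / 5)\<^sup>2 + L2 * \<eta> * \<sigma>2\<^sup>2 / real M"

lemma drift_nonneg: "0 \<le> drift"
  using params by (simp add: drift_def)

lemma round_error_nonneg: "0 \<le> round_error"
  using params by (simp add: round_error_def)

definition averaged :: "'a \<Rightarrow> 'a measure" where
  "averaged \<theta> = distr (PiM {1..M} (\<lambda>c. local_run (\<xi> c) (g c) \<eta> H \<theta>)) borel (avg M)"

text \<open>The local gradients average exactly to the gradient of \<open>F\<close>, so
  heterogeneity enters only through their norms in the drift term: hence \<zeta>/5 rather than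
  \<zeta>. The mean is left existential because the local means belong to the single agents.\<close>

lemma averaged_mean_var:
  obtains m where "mean_var (averaged \<theta>) m (2 * real H * \<eta>\<^sup>2 * \<sigma>2\<^sup>2 / real M)"
    "norm (m - \<theta> - period *\<^sub>R grad F \<theta>) \<le> period * (6 / 5 * drift + \<zeta> / 5 + norm (grad F \<theta>) / 5)"
proof -
  have "\<forall>c\<in>{1..M}. \<exists>m. mean_var (local_run (\<xi> c) (g c) \<eta> H \<theta>) m (2 * real H * \<eta>\<^sup>2 * \<sigma>2\<^sup>2) \<and>
      norm (m - \<theta> - period *\<^sub>R grad (f c) \<theta>)
        \<le> period * (6 / 5 * drift + \<zeta> / 5 + norm (grad F \<theta>) / 5)"
  proof
    fix c assume c: "c \<in> {1..M}"
    interpret local_agent "f c" Zs "\<xi> c" "g c" "gbar c" L2 L3 \<beta> \<sigma>2 \<sigma>4 \<eta> H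
      by (rule agent[OF c])
    let ?m = "local_mean \<theta> H"
    have "2 * real H * \<eta>\<^sup>2 * min (\<sigma>2\<^sup>2) (\<sigma>4\<^sup>2) \<le> 2 * real H * \<eta>\<^sup>2 * \<sigma>2\<^sup>2"
      by (intro mult_left_mono) auto
    then have "mean_var (local_run (\<xi> c) (g c) \<eta> H \<theta>) ?m (2 * real H * \<eta>\<^sup>2 * \<sigma>2\<^sup>2)"
      using local_run_mean_var[of H \<theta>] by (auto simp: mean_var_def)
    moreover have "norm (?m - \<theta> - period *\<^sub>R grad (f c) \<theta>)
        \<le> period * (6 / 5 * drift + \<zeta> / 5 + norm (grad F \<theta>) / 5)"
    proof -
      have "norm (grad (f c) \<theta>) \<le> norm (grad F \<theta>) + \<zeta>"
        using norm_triangle_ineq2[of "grad (f c) \<theta>" "grad F \<theta>"] heterogeneity[OF c, of \<theta>]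
        by (simp add: norm_minus_commute)
      then have "period * (drift + (norm (grad (f c) \<theta>) + drift) / 5)
          \<le> period * (6 / 5 * drift + \<zeta> / 5 + norm (grad F \<theta>) / 5)"
        using params(6) by (intro mult_left_mono) (simp_all add: field_simps)
      then show ?thesis
        using local_mean_drift[of \<theta>] unfolding drift_error_def drift_def[symmetric] period_def[symmetric]
        by linarith
    qed
    ultimately show "\<exists>m. mean_var (local_run (\<xi> c) (g c) \<eta> H \<theta>) m (2 * real H * \<eta>\<^sup>2 * \<sigma>2\<^sup>2) \<and>
        norm (m - \<theta> - period *\<^sub>R grad (f c) \<theta>)
          \<le> period * (6 / 5 * drift + \<zeta> / 5 + norm (grad F \<theta>) / 5)" by blast
  qed
  from bchoice[OF this] obtain m where
    m: "\<And>c. c \<in> {1..M} \<Longrightarrow> mean_var (local_run (\<xi> c) (g c) \<eta> H \<theta>) (m c) (2 * real H * \<eta>\<^sup>2 * \<sigma>2\<^sup>2)"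
      "\<And>c. c \<in> {1..M} \<Longrightarrow> norm (m c - \<theta> - period *\<^sub>R grad (f c) \<theta>)
        \<le> period * (6 / 5 * drift + \<zeta> / 5 + norm (grad F \<theta>) / 5)"
    by blast
  have mean: "avg M (\<lambda>c. m c - \<theta> - period *\<^sub>R grad (f c) \<theta>) = avg M m - \<theta> - period *\<^sub>R grad F \<theta>"
    using M by (simp add: avg_diff avg_scaleR grad_F)
  have "norm (avg M (\<lambda>c. m c - \<theta> - period *\<^sub>R grad (f c) \<theta>))
      \<le> period * (6 / 5 * drift + \<zeta> / 5 + norm (grad F \<theta>) / 5)"
    using M m(2) by (rule norm_avg_bound)
  then have "norm (avg M m - \<theta> - period *\<^sub>R grad F \<theta>) \<le> period * (6 / 5 * drift + \<zeta> / 5 + norm (grad F \<theta>) / 5)"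
    unfolding mean .
  moreover have "mean_var (averaged \<theta>) (avg M m) (2 * real H * \<eta>\<^sup>2 * \<sigma>2\<^sup>2 / real M)"
    unfolding averaged_def using M m(1) by (rule mean_var_avg)
  ultimately show ?thesis using that by blast
qed

text \<open>Integrating the smoothness inequality leaves the mean displacement, handled as one
  inexact ascent step, plus \<open>L2 / 2\<close> times the variance.\<close>

lemma averaged_descent:
  "integrable (averaged \<theta>) gap"
  "(\<integral>x. gap x \<partial>averaged \<theta>) \<le> gap \<theta> - period / 2 * (norm (grad F \<theta>))\<^sup>2 + period * round_error"
proof -
  define \<epsilon> where "\<epsilon> = 6 / 5 * drift + \<zeta> / 5"
  define V where "V = 2 * real H * \<eta>\<^sup>2 * \<sigma>2\<^sup>2 / real M"
  obtain m where P: "mean_var (averaged \<theta>) m V"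
    and m: "norm (m - \<theta> - period *\<^sub>R grad F \<theta>) \<le> period * (\<epsilon> + norm (grad F \<theta>) / 5)"
    unfolding V_def \<epsilon>_def by (rule averaged_mean_var)
  note D = mean_varD[OF P]
  interpret prob_space "averaged \<theta>" by (rule D)
  let ?v = "grad F \<theta>"
  have iF: "integrable (averaged \<theta>) F" by (rule mean_var_lipschitz(2)[OF P F_lipschitz])
  then show ig: "integrable (averaged \<theta>) gap" by (simp add: gap_def[abs_def])
  have iid: "integrable (averaged \<theta>) (\<lambda>x. x)" by (rule mean_var_integrable[OF P])
  have sq: "integrable (averaged \<theta>) (\<lambda>x. (norm (x - \<theta>))\<^sup>2)"
    "expectation (\<lambda>x. (norm (x - \<theta>))\<^sup>2) \<le> (norm (m - \<theta>))\<^sup>2 + V"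
    using bias_variance[of "\<lambda>x. x" m \<theta>] D iid by auto
  have "F \<theta> + inner ?v (m - \<theta>) - L2 / 2 * ((norm (m - \<theta>))\<^sup>2 + V)
      \<le> F \<theta> + inner ?v (m - \<theta>) - L2 / 2 * expectation (\<lambda>x. (norm (x - \<theta>))\<^sup>2)"
    using sq(2) params(1) by simp
  also have "\<dots> = expectation (\<lambda>x. F \<theta> + inner ?v (x - \<theta>) - L2 / 2 * (norm (x - \<theta>))\<^sup>2)"
    using iid sq(1) D(3) by (simp add: prob_space)
  also have "\<dots> \<le> expectation F"
  proof (rule integral_mono)
    show "integrable (averaged \<theta>) (\<lambda>x. F \<theta> + inner ?v (x - \<theta>) - L2 / 2 * (norm (x - \<theta>))\<^sup>2)"
      using iid sq(1) by simp
    show "F \<theta> + inner ?v (x - \<theta>) - L2 / 2 * (norm (x - \<theta>))\<^sup>2 \<le> F x" for x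
      using F_GDERIV[folded grad_F] grad_F_lipschitz by (rule descent_lower_bound)
  qed (rule iF)
  finally have 1: "F \<theta> + inner ?v (m - \<theta>) - L2 / 2 * (norm (m - \<theta>))\<^sup>2 - L2 / 2 * V \<le> expectation F"
    by (simp add: distrib_left)
  define e where "e = (1 / period) *\<^sub>R (m - \<theta> - period *\<^sub>R ?v)"
  have "norm e \<le> \<epsilon> + norm ?v / 5"
    using m params(6) by (simp add: e_def pos_divide_le_eq mult.commute)
  moreover have me: "m - \<theta> = period *\<^sub>R (?v + e)"
    using params(6) by (simp add: e_def scaleR_add_right)
  moreover have "0 \<le> \<epsilon>" using drift_nonneg \<zeta> by (simp add: \<epsilon>_def)
  ultimately have 2: "period * ((norm ?v)\<^sup>2 / 2 - 6 * \<epsilon>\<^sup>2) \<le> inner ?v (m - \<theta>) - L2 / 2 * (norm (m - \<theta>))\<^sup>2"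
    using params unfolding me by (intro inexact_ascent) auto
  have 3: "period * round_error = period * (6 * \<epsilon>\<^sup>2) + L2 / 2 * V"
    by (simp add: round_error_def \<epsilon>_def V_def period_def power2_eq_square distrib_left)
  have "expectation gap = Fstar - expectation F"
    using iF by (simp add: gap_def[abs_def] prob_space)
  then show "expectation gap \<le> gap \<theta> - period / 2 * (norm ?v)\<^sup>2 + period * round_error"
    using 1 2 unfolding 3 by (simp add: gap_def right_diff_distrib)
qed

section \<open>One communication round as a Markov kernel\<close>

abbreviation fed_kernel :: "'a \<Rightarrow> 'a measure" where
  "fed_kernel \<equiv> fed_round M H \<xi> g \<eta> T"

lemma local_run_kernel: "c \<in> {1..M} \<Longrightarrow> local_run (\<xi> c) (g c) \<eta> H \<in> borel \<rightarrow>\<^sub>M prob_algebra borel"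
  by (rule local_agent.local_run_measurable[OF agent])

lemma avg_measurable: "avg M \<in> borel_measurable (PiM {1..M} (\<lambda>_. borel :: 'a measure))"
  unfolding avg_def[abs_def] by measurable

lemma fed_kernel_measurable: "fed_kernel \<in> borel \<rightarrow>\<^sub>M prob_algebra borel"
proof -
  have "(\<lambda>\<theta>. PiM {1..M} (\<lambda>c. local_run (\<xi> c) (g c) \<eta> H \<theta>)) \<in> borel \<rightarrow>\<^sub>M prob_algebra (PiM {1..M} (\<lambda>_. borel))"
    by (rule measurable_PiM_prob_algebra[OF finite_atLeastAtMost local_run_kernel])
  moreover have "(\<lambda>x. return borel (T (avg M x))) \<in> PiM {1..M} (\<lambda>_. borel) \<rightarrow>\<^sub>M prob_algebra borel"
    using measurable_compose[OF measurable_compose[OF avg_measurable T] measurable_return_prob_space] .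
  ultimately show ?thesis
    unfolding fed_round_def[abs_def] by (rule measurable_bind_prob_space)
qed

lemma fed_kernel_eq: "fed_kernel \<theta> = distr (averaged \<theta>) borel T"
proof -
  let ?P = "PiM {1..M} (\<lambda>c. local_run (\<xi> c) (g c) \<eta> H \<theta>)"
  have K: "prob_space (local_run (\<xi> c) (g c) \<eta> H \<theta>)" "sets (local_run (\<xi> c) (g c) \<eta> H \<theta>) = sets borel"
    if "c \<in> {1..M}" for c
    using measurable_space[OF local_run_kernel[OF that], of \<theta>] by (auto simp: space_prob_algebra)
  interpret prob_space ?P using K by (intro prob_space_PiM) auto
  have "sets ?P = sets (PiM {1..M} (\<lambda>_. borel))" using K by (intro sets_PiM_cong) auto
  then have a: "avg M \<in> borel_measurable ?P"
    using avg_measurable measurable_cong_sets by blast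
  have "fed_kernel \<theta> = distr ?P borel (\<lambda>x. T (avg M x))"
    unfolding fed_round_def using not_empty measurable_compose[OF a T] by (rule bind_return_distr')
  also have "\<dots> = distr (averaged \<theta>) borel T"
    unfolding averaged_def using distr_distr[OF T a] by (simp add: comp_def)
  finally show ?thesis .
qed

text \<open>A measurable set containing the range of \<^term>\<open>T\<close>, which itself need not be measurable.\<close>

definition on_range :: "'a \<Rightarrow> bool" where
  "on_range x \<longleftrightarrow> gap x \<le> L2 / \<mu> \<and> \<mu> * (gap x)\<^sup>2 \<le> (norm (grad F x))\<^sup>2 + \<zeta>\<^sup>2"

lemma on_range_measurable [measurable]: "Measurable.pred borel on_range"
  unfolding on_range_def[abs_def] by measurable

lemma averaged_prob: "prob_space (averaged \<theta>)" "sets (averaged \<theta>) = sets borel"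
proof -
  obtain m V where P: "mean_var (averaged \<theta>) m V" by (rule averaged_mean_var)
  show "prob_space (averaged \<theta>)" "sets (averaged \<theta>) = sets borel"
    by (rule mean_varD[OF P])+
qed

lemma T_averaged: "T \<in> averaged \<theta> \<rightarrow>\<^sub>M borel"
  using T averaged_prob(2) measurable_cong_sets by blast

lemma fed_kernel_on_range: "AE x in fed_kernel \<theta>. on_range x"
  unfolding fed_kernel_eq using gap_T_le gap_T_square_le
  by (subst AE_distr_iff[OF T_averaged]) (auto simp: on_range_def)

text \<open>\<open>T\<close> does not increase the gap, so 0 \<le> gap (T x) \<le> gap x transfers
  both integrability and the bound.\<close>

lemma fed_kernel_descent:
  "integrable (fed_kernel \<theta>) gap"
  "(\<integral>x. gap x \<partial>fed_kernel \<theta>) \<le> gap \<theta> - period / 2 * (norm (grad F \<theta>))\<^sup>2 + period * round_error"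
proof -
  have le: "gap (T x) \<le> gap x" for x using T_ascent[of x] by (simp add: gap_def)
  have i: "integrable (averaged \<theta>) (\<lambda>x. gap (T x))"
  proof (rule Bochner_Integration.integrable_bound[OF averaged_descent(1)])
    show "(\<lambda>x. gap (T x)) \<in> borel_measurable (averaged \<theta>)"
      using measurable_compose[OF T_averaged gap_measurable] .
    show "AE x in averaged \<theta>. norm (gap (T x)) \<le> norm (gap x)"
      using le gap_nonneg by simp
  qed
  then show "integrable (fed_kernel \<theta>) gap"
    unfolding fed_kernel_eq by (simp add: integrable_distr_eq[OF T_averaged])
  have "(\<integral>x. gap x \<partial>fed_kernel \<theta>) = (\<integral>x. gap (T x) \<partial>averaged \<theta>)"
    unfolding fed_kernel_eq by (simp add: integral_distr[OF T_averaged])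
  also have "\<dots> \<le> (\<integral>x. gap x \<partial>averaged \<theta>)"
    using i averaged_descent(1) le by (intro integral_mono) auto
  finally show "(\<integral>x. gap x \<partial>fed_kernel \<theta>) \<le> gap \<theta> - period / 2 * (norm (grad F \<theta>))\<^sup>2 + period * round_error"
    using averaged_descent(2)[of \<theta>] by linarith
qed

section \<open>Laws and expected gaps over several rounds\<close>

definition law :: "'a \<Rightarrow> nat \<Rightarrow> 'a measure" where
  "law = proj_fedavg M H \<xi> g \<eta> T"

lemma law_0: "law \<theta> 0 = return borel \<theta>"
  and law_Suc: "law \<theta> (Suc r) = law \<theta> r \<bind> fed_kernel"
  by (simp_all add: law_def)

lemma law_prob_algebra: "law \<theta> r \<in> space (prob_algebra borel)"
proof (induction r)
  case 0
  then show ?case by (simp add: law_0 space_prob_algebra prob_space_return)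
next
  case (Suc r)
  then show ?case unfolding law_Suc
    using prob_space_bind'[OF Suc fed_kernel_measurable] sets_bind'[OF Suc fed_kernel_measurable]
    by (simp add: space_prob_algebra)
qed

lemma law_prob: "prob_space (law \<theta> r)" "sets (law \<theta> r) = sets borel"
  using law_prob_algebra[of \<theta> r] by (auto simp: space_prob_algebra)

lemma fed_kernel_law: "fed_kernel \<in> law \<theta> r \<rightarrow>\<^sub>M prob_algebra borel"
  using fed_kernel_measurable law_prob(2) measurable_cong_sets by blast

lemma law_on_range: "AE x in law \<theta> (Suc r). on_range x"
proof -
  show ?thesis
    unfolding law_Suc using fed_kernel_on_range
    by (subst AE_bind[OF measurable_prob_algebraD[OF fed_kernel_law]]) auto
qed

lemma law_measurable: "h \<in> borel_measurable borel \<Longrightarrow> h \<in> borel_measurable (law \<theta> r)"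
  using law_prob(2) measurable_cong_sets by blast

text \<open>The index \<open>Suc r\<close> matters: after at least one application of
  \<open>T\<close> the gap is almost surely at most \<open>L2 / \<mu>\<close>.\<close>

lemma law_integrable: "integrable (law \<theta> (Suc r)) gap" "integrable (law \<theta> (Suc r)) (\<lambda>x. (gap x)\<^sup>2)"
proof -
  interpret prob_space "law \<theta> (Suc r)" by (rule law_prob)
  have g: "AE x in law \<theta> (Suc r). norm (gap x) \<le> L2 / \<mu>"
    using law_on_range[of \<theta> r] gap_nonneg by (auto simp: on_range_def)
  then show "integrable (law \<theta> (Suc r)) gap"
    by (intro integrable_const_bound law_measurable) auto
  have "AE x in law \<theta> (Suc r). norm ((gap x)\<^sup>2) \<le> (L2 / \<mu>)\<^sup>2"
    using g by eventually_elim (use gap_nonneg in \<open>auto intro: power_mono\<close>)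
  then show "integrable (law \<theta> (Suc r)) (\<lambda>x. (gap x)\<^sup>2)"
    by (intro integrable_const_bound law_measurable) auto
qed

definition expected_gap :: "'a \<Rightarrow> nat \<Rightarrow> real" where
  "expected_gap \<theta> r = (\<integral>x. gap x \<partial>law \<theta> r)"

lemma expected_gap_bounds: "0 \<le> expected_gap \<theta> (Suc r)" "expected_gap \<theta> (Suc r) \<le> L2 / \<mu>"
proof -
  interpret prob_space "law \<theta> (Suc r)" by (rule law_prob)
  show "0 \<le> expected_gap \<theta> (Suc r)"
    unfolding expected_gap_def using gap_nonneg by (intro integral_nonneg_AE) auto
  have "expected_gap \<theta> (Suc r) \<le> (\<integral>x. L2 / \<mu> \<partial>law \<theta> (Suc r))"
    unfolding expected_gap_def using law_on_range[of \<theta> r]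
    by (intro integral_mono_AE law_integrable) (auto simp: on_range_def)
  then show "expected_gap \<theta> (Suc r) \<le> L2 / \<mu>" by (simp add: prob_space)
qed

text \<open>The initial point may lie outside the range of \<open>T\<close>, where (QL) gives no
  uniform constant, so the gradient term is simply discarded.\<close>

lemma expected_gap_first: "expected_gap \<theta> 1 \<le> gap \<theta> + period * round_error"
proof -
  have "law \<theta> 1 = fed_kernel \<theta>"
    using bind_return[OF measurable_prob_algebraD[OF fed_kernel_measurable], of \<theta>]
    by (simp add: law_0 law_Suc)
  moreover have "0 \<le> period / 2 * (norm (grad F \<theta>))\<^sup>2" using params by simp
  ultimately show ?thesis
    unfolding expected_gap_def using fed_kernel_descent(2)[of \<theta>] by simp
qed

text \<open>On the range of \<open>T\<close> the squared gradient is at least \<mu> gap^2 -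
  \<zeta>^2, which explains the extra \<zeta>^2 / 2; Jensen then replaces the mean of the squared
  gap by the square of its mean.\<close>

lemma expected_gap_step:
  "expected_gap \<theta> (Suc (Suc r)) \<le> expected_gap \<theta> (Suc r) - period * \<mu> / 2 * (expected_gap \<theta> (Suc r))\<^sup>2
    + period * (round_error + \<zeta>\<^sup>2 / 2)"
proof -
  let ?P = "law \<theta> (Suc r)" and ?a = "period * \<mu> / 2" and ?N = "period * (round_error + \<zeta>\<^sup>2 / 2)"
  interpret prob_space ?P by (rule law_prob)
  define x where "x = expected_gap \<theta> (Suc r)"
  have bind: "law \<theta> (Suc (Suc r)) = ?P \<bind> fed_kernel" by (rule law_Suc)
  note ib = integral_bind_kernel_real[OF fed_kernel_law _ not_empty, of gap, folded bind, OF law_integrable(1)]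
  have "expected_gap \<theta> (Suc (Suc r)) = (\<integral>y. \<integral>x. gap x \<partial>fed_kernel y \<partial>?P)"
    unfolding expected_gap_def by (rule ib)
  also have "\<dots> \<le> (\<integral>y. gap y - ?a * (gap y)\<^sup>2 + ?N \<partial>?P)"
  proof (rule integral_mono_AE)
    show "integrable ?P (\<lambda>y. \<integral>x. gap x \<partial>fed_kernel y)" by (rule ib)
    show "integrable ?P (\<lambda>y. gap y - ?a * (gap y)\<^sup>2 + ?N)" using law_integrable by simp
    show "AE y in ?P. (\<integral>x. gap x \<partial>fed_kernel y) \<le> gap y - ?a * (gap y)\<^sup>2 + ?N"
      using law_on_range[of \<theta> r]
    proof eventually_elim
      case (elim y)
      then have "period / 2 * (\<mu> * (gap y)\<^sup>2) \<le> period / 2 * ((norm (grad F y))\<^sup>2 + \<zeta>\<^sup>2)"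
        using params by (intro mult_left_mono) (auto simp: on_range_def)
      then show ?case using fed_kernel_descent(2)[of y] by (simp add: algebra_simps)
    qed
  qed
  also have "\<dots> = x - ?a * (\<integral>y. (gap y)\<^sup>2 \<partial>?P) + ?N"
    using law_integrable by (simp add: prob_space x_def expected_gap_def)
  also have "\<dots> \<le> x - ?a * x\<^sup>2 + ?N"
  proof -
    have "0 \<le> (\<integral>y. (gap y - x)\<^sup>2 \<partial>?P)" by (intro integral_nonneg_AE) auto
    also have "\<dots> = (\<integral>y. (gap y)\<^sup>2 - 2 * x * gap y + x\<^sup>2 \<partial>?P)"
      by (simp add: power2_eq_square algebra_simps)
    also have "\<dots> = (\<integral>y. (gap y)\<^sup>2 \<partial>?P) - 2 * x * x + x\<^sup>2"
      using law_integrable by (simp add: prob_space x_def expected_gap_def)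
    finally have "x\<^sup>2 \<le> (\<integral>y. (gap y)\<^sup>2 \<partial>?P)" by (simp add: power2_eq_square)
    then have "?a * x\<^sup>2 \<le> ?a * (\<integral>y. (gap y)\<^sup>2 \<partial>?P)"
      using params \<mu> by (intro mult_left_mono) auto
    then show ?thesis by simp
  qed
  finally show ?thesis by (simp add: x_def)
qed

text \<open>\<open>quadratic_recursion\<close> runs from the first round on, with a = period \<mu> /
  2 and B = L2 / \<mu>, so 2 a B = period L2; its \<open>s\<close> is chosen so that a s^2 = period
  N.\<close>

lemma expected_gap_rate:
  "expected_gap \<theta> (Suc r) \<le> sqrt (2 * (round_error + \<zeta>\<^sup>2 / 2) / \<mu>)
    + 2 * gap \<theta> / (1 + real (Suc r) * gap \<theta> * (period * \<mu>)) + (round_error + \<zeta>\<^sup>2 / 2) / (6 * L2)"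
proof -
  define N where "N = round_error + \<zeta>\<^sup>2 / 2"
  define s where "s = sqrt (2 * N / \<mu>)"
  define Y where "Y = min (L2 / \<mu>) (gap \<theta> + period * N)"
  have N: "0 \<le> N" "round_error \<le> N" using round_error_nonneg by (auto simp: N_def)
  have pN: "0 \<le> period * N" using N params by simp
  have s: "0 \<le> s" "s\<^sup>2 = 2 * N / \<mu>" using N \<mu> by (auto simp: s_def)
  have aB: "2 * (period * \<mu> / 2) * (L2 / \<mu>) \<le> 1" using params \<mu> by simp
  have "expected_gap \<theta> 1 \<le> gap \<theta> + period * N"
    using expected_gap_first[of \<theta>] mult_left_mono[OF N(2), of period] params(6) by linarith
  then have "expected_gap \<theta> (Suc 0) \<le> Y"
    using expected_gap_bounds[of \<theta> 0] by (simp add: Y_def)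
  then have "expected_gap \<theta> (Suc r) \<le> s + Y / (1 + period * \<mu> / 2 * real r * Y)"
    using params \<mu> s aB expected_gap_bounds expected_gap_step[of \<theta>] gap_nonneg[of \<theta>] pN
    by (intro quadratic_recursion[where B = "L2 / \<mu>" and y = "\<lambda>r. expected_gap \<theta> (Suc r)"])
      (auto simp: Y_def N_def[symmetric])
  also have "Y / (1 + period * \<mu> / 2 * real r * Y) \<le>
      2 * gap \<theta> / (1 + real (Suc r) * gap \<theta> * (2 * (period * \<mu> / 2))) + period * N"
    unfolding Y_def using params \<mu> aB gap_nonneg pN by (intro recursion_rate) auto
  also have "period * N \<le> N / (6 * L2)"
    using mult_right_mono[OF params(5) N(1)] params(1) by (simp add: pos_le_divide_eq mult_ac)
  finally show ?thesis unfolding s_def N_def by simp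
qed

lemma expected_gap_bound:
  "expected_gap \<theta> (Suc r) \<le> 20 * (gap \<theta> / (1 + real (Suc r) * gap \<theta> * \<eta> * real H * \<mu>)
     + (\<zeta> + \<beta>) / sqrt \<mu> + (\<zeta>\<^sup>2 + \<beta>\<^sup>2) / L2
     + sqrt (\<eta> * L2 * \<sigma>2\<^sup>2 / (real M * \<mu>)) + \<eta> * \<sigma>2\<^sup>2 / real M
     + \<eta>\<^sup>2 * L3 * real H * \<sigma>4\<^sup>2 / sqrt \<mu> + \<eta> ^ 4 * L3\<^sup>2 * (real H)\<^sup>2 * \<sigma>4 ^ 4 / L2)"
proof -
  define E where "E = \<eta>\<^sup>2 * L3 * real H * \<sigma>4\<^sup>2"
  define w where "w = \<eta> * L2 * \<sigma>2\<^sup>2 / real M"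
  define Q where "Q = gap \<theta> / (1 + real (Suc r) * gap \<theta> * (period * \<mu>))"
  have pos: "0 \<le> E" "0 \<le> w" using params by (auto simp: E_def w_def)
  have N: "round_error + \<zeta>\<^sup>2 / 2 = 6 * (6 / 5 * (\<beta> + 2 * E) + \<zeta> / 5)\<^sup>2 + w + \<zeta>\<^sup>2 / 2"
    by (simp add: round_error_def drift_def E_def w_def mult_ac)
  have "0 \<le> Q" using gap_nonneg[of \<theta>] params \<mu> by (simp add: Q_def)
  have "expected_gap \<theta> (Suc r) \<le>
      20 * ((\<zeta> + \<beta>) / sqrt \<mu> + E / sqrt \<mu> + sqrt (w / \<mu>)) + 2 * Q
      + 20 * ((\<zeta>\<^sup>2 + \<beta>\<^sup>2) / L2 + E\<^sup>2 / L2 + w / L2)"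
    using expected_gap_rate[of \<theta> r] unfolding N
    using error_terms_bound[OF \<zeta> params(3) pos \<mu> params(1)] by (simp add: Q_def)
  moreover have "w / \<mu> = \<eta> * L2 * \<sigma>2\<^sup>2 / (real M * \<mu>)" "w / L2 = \<eta> * \<sigma>2\<^sup>2 / real M"
    "E\<^sup>2 = \<eta> ^ 4 * L3\<^sup>2 * (real H)\<^sup>2 * \<sigma>4 ^ 4"
    using params(1) by (auto simp: w_def E_def power_mult_distrib)
  moreover have "Q = gap \<theta> / (1 + real (Suc r) * gap \<theta> * \<eta> * real H * \<mu>)"
    by (simp add: Q_def period_def mult_ac)
  ultimately show ?thesis using \<open>0 \<le> Q\<close> E_def by simp
qed

end

theorem theorem4p2:
  shows "\<exists>C::real. 0 < C \<and> C \<le> universal_cap \<and>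
    (\<forall>(M::nat) (H::nat) (R::nat)
       (f :: nat \<Rightarrow> real ^ 'd \<Rightarrow> real) (F :: real ^ 'd \<Rightarrow> real) (Fstar::real)
       (Zs :: 'z measure) (\<xi> :: nat \<Rightarrow> real ^ 'd \<Rightarrow> 'z measure)
       (g :: nat \<Rightarrow> 'z \<Rightarrow> real ^ 'd \<Rightarrow> real ^ 'd) (gbar :: nat \<Rightarrow> real ^ 'd \<Rightarrow> real ^ 'd)
       (T :: real ^ 'd \<Rightarrow> real ^ 'd) (\<theta>0 :: real ^ 'd)
       (L\<^sub>1::real) (L\<^sub>2::real) (L\<^sub>3::real) (\<zeta>::real) (\<beta>::real) (\<sigma>\<^sub>2::real) (\<sigma>\<^sub>4::real)
       (\<mu>::real) (\<eta>::real).
      1 \<le> M \<and> 1 \<le> H \<and> 1 \<le> R \<and>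
      (\<forall>c\<in>{1..M}. three_times_differentiable (f c) \<and> bdd_above (range (f c))) \<and>
      F = (\<lambda>\<theta>. avg M (\<lambda>c. f c \<theta>)) \<and>
      Fstar = avg M (\<lambda>c. fstar (f c)) \<and>
      (\<forall>c\<in>{1..M}. \<xi> c \<in> borel \<rightarrow>\<^sub>M prob_algebra Zs) \<and>
      (\<forall>c\<in>{1..M}. (\<lambda>(z, \<theta>). g c z \<theta>) \<in> borel_measurable (Zs \<Otimes>\<^sub>M borel)) \<and>
      (\<forall>c\<in>{1..M}. \<forall>\<theta>. integrable (\<xi> c \<theta>) (\<lambda>z. g c z \<theta>)) \<and>
      gbar = (\<lambda>c. mean_grad (\<xi> c) (g c)) \<and>
      T \<in> borel_measurable borel \<and>
      0 \<le> L\<^sub>1 \<and> 0 < L\<^sub>2 \<and> 0 \<le> L\<^sub>3 \<and> 0 \<le> \<zeta> \<and> 0 \<le> \<beta> \<and> 0 \<le> \<sigma>\<^sub>2 \<and> 0 \<le> \<sigma>\<^sub>4 \<and>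
      (\<forall>c\<in>{1..M}. \<forall>\<theta>. norm (grad (f c) \<theta>) \<le> L\<^sub>1) \<and>
      (\<forall>c\<in>{1..M}. \<forall>\<theta> u. norm (hess (f c) \<theta> u) \<le> L\<^sub>2 * norm u) \<and>
      (\<forall>c\<in>{1..M}. \<forall>\<theta> \<theta>'. norm (gbar c \<theta> - gbar c \<theta>') \<le> L\<^sub>2 * norm (\<theta> - \<theta>')) \<and>
      (\<forall>c\<in>{1..M}. \<forall>\<theta> u. norm (third_deriv (f c) \<theta> u u) \<le> L\<^sub>3 * (norm u)\<^sup>2) \<and>
      (\<forall>c\<in>{1..M}. \<forall>\<theta>. norm (grad F \<theta> - grad (f c) \<theta>) \<le> \<zeta>) \<and>
      (\<forall>c\<in>{1..M}. \<forall>\<theta>. norm (grad (f c) \<theta> - gbar c \<theta>) \<le> \<beta>) \<and>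
      (\<forall>c\<in>{1..M}. \<forall>\<theta>.
         (\<integral>\<^sup>+z. ennreal (norm (g c z \<theta> - gbar c \<theta>) ^ 2) \<partial>\<xi> c \<theta>) \<le> ennreal (\<sigma>\<^sub>2 ^ 2)) \<and>
      (\<forall>c\<in>{1..M}. \<forall>\<theta>.
         (\<integral>\<^sup>+z. ennreal (norm (g c z \<theta> - gbar c \<theta>) ^ 4) \<partial>\<xi> c \<theta>) \<le> ennreal (\<sigma>\<^sub>4 ^ 4)) \<and>
      (\<forall>c\<in>{1..M}. \<forall>\<theta>. QL_mu (f c) \<theta> > 0) \<and>
      0 < \<mu> \<and>
      (\<forall>\<theta>. (MIN c\<in>{1..M}. QL_mu (f c) (T \<theta>)) \<ge> ereal \<mu> \<and> F (T \<theta>) \<ge> F \<theta>) \<and>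
      0 < \<eta> \<and> \<eta> * real H * L\<^sub>2 \<le> 1 / 6 \<and>
      32 * \<eta>\<^sup>2 * (real H)\<^sup>2 * L\<^sub>3\<^sup>2 * L\<^sub>1\<^sup>2 \<le> L\<^sub>2\<^sup>2
      \<longrightarrow>
      integrable (proj_fedavg M H \<xi> g \<eta> T \<theta>0 R) (\<lambda>\<theta>. Fstar - F \<theta>) \<and>
      (\<integral>\<theta>. Fstar - F \<theta> \<partial>proj_fedavg M H \<xi> g \<eta> T \<theta>0 R)
        \<le> C * ((Fstar - F \<theta>0) / (1 + real R * (Fstar - F \<theta>0) * \<eta> * real H * \<mu>)
               + (\<zeta> + \<beta>) / sqrt \<mu>
               + (\<zeta>\<^sup>2 + \<beta>\<^sup>2) / L\<^sub>2
               + sqrt (\<eta> * L\<^sub>2 * \<sigma>\<^sub>2\<^sup>2 / (real M * \<mu>))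
               + \<eta> * \<sigma>\<^sub>2\<^sup>2 / real M
               + \<eta>\<^sup>2 * L\<^sub>3 * real H * \<sigma>\<^sub>4\<^sup>2 / sqrt \<mu>
               + \<eta> ^ 4 * L\<^sub>3\<^sup>2 * (real H)\<^sup>2 * \<sigma>\<^sub>4 ^ 4 / L\<^sub>2))"
proof (intro exI[of _ 20] conjI[of "0 < 20"] conjI[of "20 \<le> universal_cap"] allI impI, goal_cases)
  \<comment> \<open>The witness 20 is the factor of \<open>expected_gap_bound\<close>; it is a
    numeral, free of the dimension and of the sample space.\<close>
  case 1
  show ?case by simp
next
  case 2
  show ?case by (simp add: universal_cap_def)
next
  case (3 M H R f F Fstar Zs \<xi> g gbar T \<theta>0 L1 L2 L3 \<zeta> \<beta> \<sigma>2 \<sigma>4 \<mu> \<eta>)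
  then show ?case
  proof (elim conjE)
    assume M: "1 \<le> M"
      and H: "1 \<le> H"
      and R: "1 \<le> R"
      and f: "(\<forall>c\<in>{1..M}. three_times_differentiable (f c) \<and> bdd_above (range (f c)))"
      and F: "F = (\<lambda>\<theta>. avg M (\<lambda>c. f c \<theta>))"
      and Fstar: "Fstar = avg M (\<lambda>c. fstar (f c))"
      and \<xi>: "(\<forall>c\<in>{1..M}. \<xi> c \<in> borel \<rightarrow>\<^sub>M prob_algebra Zs)"
      and g: "(\<forall>c\<in>{1..M}. (\<lambda>(z, \<theta>). g c z \<theta>) \<in> borel_measurable (Zs \<Otimes>\<^sub>M borel))"
      and gint: "(\<forall>c\<in>{1..M}. \<forall>\<theta>. integrable (\<xi> c \<theta>) (\<lambda>z. g c z \<theta>))"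
      and gbar: "gbar = (\<lambda>c. mean_grad (\<xi> c) (g c))"
      and T: "T \<in> borel_measurable borel"
      and L2: "0 < L2"
      and L3: "0 \<le> L3"
      and \<zeta>: "0 \<le> \<zeta>"
      and \<beta>: "0 \<le> \<beta>"
      and L1: "(\<forall>c\<in>{1..M}. \<forall>\<theta>. norm (grad (f c) \<theta>) \<le> L1)"
      and hess: "(\<forall>c\<in>{1..M}. \<forall>\<theta> u. norm (hess (f c) \<theta> u) \<le> L2 * norm u)"
      and glip: "(\<forall>c\<in>{1..M}. \<forall>\<theta> \<theta>'. norm (gbar c \<theta> - gbar c \<theta>') \<le> L2 * norm (\<theta> - \<theta>'))"
      and third: "(\<forall>c\<in>{1..M}. \<forall>\<theta> u. norm (third_deriv (f c) \<theta> u u) \<le> L3 * (norm u)\<^sup>2)"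
      and het: "(\<forall>c\<in>{1..M}. \<forall>\<theta>. norm (grad F \<theta> - grad (f c) \<theta>) \<le> \<zeta>)"
      and bias: "(\<forall>c\<in>{1..M}. \<forall>\<theta>. norm (grad (f c) \<theta> - gbar c \<theta>) \<le> \<beta>)"
      and noise2: "(\<forall>c\<in>{1..M}. \<forall>\<theta>. (\<integral>\<^sup>+z. ennreal (norm (g c z \<theta> - gbar c \<theta>) ^ 2) \<partial>\<xi> c \<theta>) \<le> ennreal (\<sigma>2 ^ 2))"
      and noise4: "(\<forall>c\<in>{1..M}. \<forall>\<theta>. (\<integral>\<^sup>+z. ennreal (norm (g c z \<theta> - gbar c \<theta>) ^ 4) \<partial>\<xi> c \<theta>) \<le> ennreal (\<sigma>4 ^ 4))"
      and \<mu>: "0 < \<mu>"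
      and QL: "(\<forall>\<theta>. (MIN c\<in>{1..M}. QL_mu (f c) (T \<theta>)) \<ge> ereal \<mu> \<and> F (T \<theta>) \<ge> F \<theta>)"
      and \<eta>: "0 < \<eta>"
      and \<eta>H: "\<eta> * real H * L2 \<le> 1 / 6"
    interpret federation M H f F Fstar Zs \<xi> g gbar T L1 L2 L3 \<zeta> \<beta> \<sigma>2 \<sigma>4 \<mu> \<eta>
    proof (rule federation.intro)
      fix c assume c: "c \<in> {1..M}"
      show "local_agent (f c) Zs (\<xi> c) (g c) (gbar c) L2 L3 \<beta> \<sigma>2 \<sigma>4 \<eta> H"
        by (rule local_agent.intro)
          (use c f \<xi> g gint gbar L2 L3 \<beta> hess glip third bias noise2 noise4 \<eta> \<eta>H in auto)
      show "ereal \<mu> \<le> QL_mu (f c) (T \<theta>)" for \<theta>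
      proof -
        have "ereal \<mu> \<le> (MIN c\<in>{1..M}. QL_mu (f c) (T \<theta>))" using QL by blast
        also have "\<dots> \<le> QL_mu (f c) (T \<theta>)" using c by (intro Min_le) auto
        finally show ?thesis .
      qed
    qed (use M H f F Fstar T \<zeta> L1 het \<mu> QL in auto)
    \<comment> \<open>At least one round has been played, so the bounds for laws with index
      \<open>Suc r\<close> apply.\<close>
    obtain r where r: "R = Suc r" using R by (cases R) auto
    show ?thesis
      using law_integrable(1)[of \<theta>0 r] expected_gap_bound[of \<theta>0 r]
      unfolding r expected_gap_def law_def gap_def[abs_def] by (rule conjI)
  qed
qed

end
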